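(* It is provable in ZF (without the Axiom of Choice) that for a countably infinite set $X$ there exists an injective mapping from $2^{2^{\omega}}$ into the set of precomplete clones on $X$.
   Context: Let $\mathcal O^{(n)}$ be the set of all functions $X^n\to X$ ($n\ge 1$) and $\mathcal O=\bigcup_{n\ge1}\mathcal O^{(n)}$. A clone on $X$ is a subset of $\mathcal O$ that contains all projections and is closed under composition. A clone $\mathcal C\neq\mathcal O$ is precomplete if there is no clone strictly between $\mathcal C$ and $\mathcal O$. Here $2^{2^\omega}$ is the set of all functions from $2^\omega$ (the set of infinite 0-1-sequences) to $\{0,1\}$. *)

theory Defs
  imports Main
begin

section \<open>First-order logic in the language of set theory\<close>

text \<open>
  Provability in ZF is a statement about formal derivations, and the logic of HOL contains a
  choice operator. So formulas, derivations and the axioms of ZF are represented as objects.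
  The only terms are variables, which are de Bruijn indices.
\<close>

datatype fm = Mem nat nat | Eq nat nat | Falsum | Imp fm fm | All fm

primrec rename :: "(nat \<Rightarrow> nat) \<Rightarrow> fm \<Rightarrow> fm" where
  "rename r (Mem x y) = Mem (r x) (r y)"
| "rename r (Eq x y) = Eq (r x) (r y)"
| "rename r Falsum = Falsum"
| "rename r (Imp p q) = Imp (rename r p) (rename r q)"
| "rename r (All p) = All (rename (case_nat 0 (\<lambda>n. Suc (r n))) p)"

primrec fv :: "fm \<Rightarrow> nat set" where
  "fv (Mem x y) = {x, y}"
| "fv (Eq x y) = {x, y}"
| "fv Falsum = {}"
| "fv (Imp p q) = fv p \<union> fv q"
| "fv (All p) = {n. Suc n \<in> fv p}"

abbreviation lift :: "fm \<Rightarrow> fm" where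
  "lift \<equiv> rename Suc"

abbreviation subst :: "fm \<Rightarrow> nat \<Rightarrow> fm" where
  "subst p x \<equiv> rename (case_nat x (\<lambda>n. n)) p"

text \<open>
  Natural deduction for classical first-order logic with equality. In \<open>AllI\<close>, lifting the
  context makes the variable \<open>0\<close> fresh for it.
\<close>

inductive derivable :: "fm set \<Rightarrow> fm \<Rightarrow> bool" (infix "\<turnstile>" 50) where
  Assm: "p \<in> \<Gamma> \<Longrightarrow> \<Gamma> \<turnstile> p"
| ImpI: "insert p \<Gamma> \<turnstile> q \<Longrightarrow> \<Gamma> \<turnstile> Imp p q"
| ImpE: "\<Gamma> \<turnstile> Imp p q \<Longrightarrow> \<Gamma> \<turnstile> p \<Longrightarrow> \<Gamma> \<turnstile> q"
| Raa: "insert (Imp p Falsum) \<Gamma> \<turnstile> Falsum \<Longrightarrow> \<Gamma> \<turnstile> p"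
| AllI: "lift ` \<Gamma> \<turnstile> p \<Longrightarrow> \<Gamma> \<turnstile> All p"
| AllE: "\<Gamma> \<turnstile> All p \<Longrightarrow> \<Gamma> \<turnstile> subst p x"
| EqRefl: "\<Gamma> \<turnstile> Eq x x"
| EqSubst: "\<Gamma> \<turnstile> Eq x y \<Longrightarrow> \<Gamma> \<turnstile> subst p x \<Longrightarrow> \<Gamma> \<turnstile> subst p y"


section \<open>Writing formulas with bound variables\<close>

text \<open>
  To write concrete formulas readably we use functions from the number \<open>d\<close> of enclosing
  quantifiers to formulas. A variable is then named by its level, i.e. the number of quantifiers
  enclosing its own binder; inside \<open>d\<close> quantifiers, level \<open>l < d\<close> has the index \<open>d - Suc l\<close>.
  A closed formula is obtained by application to \<open>0\<close>.
\<close>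

type_synonym lfm = "nat \<Rightarrow> fm"

definition mem_l :: "nat \<Rightarrow> nat \<Rightarrow> lfm" (infix "\<^bold>\<in>" 50) where
  "(x \<^bold>\<in> y) = (\<lambda>d. Mem (d - Suc x) (d - Suc y))"

definition eq_l :: "nat \<Rightarrow> nat \<Rightarrow> lfm" (infix "\<^bold>=" 50) where
  "(x \<^bold>= y) = (\<lambda>d. Eq (d - Suc x) (d - Suc y))"

definition imp_l :: "lfm \<Rightarrow> lfm \<Rightarrow> lfm" (infixr "\<^bold>\<longrightarrow>" 25) where
  "(p \<^bold>\<longrightarrow> q) = (\<lambda>d. Imp (p d) (q d))"

definition not_l :: "lfm \<Rightarrow> lfm" ("\<^bold>\<not> _" [40] 40) where
  "(\<^bold>\<not> p) = (\<lambda>d. Imp (p d) Falsum)"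

definition and_l :: "lfm \<Rightarrow> lfm \<Rightarrow> lfm" (infixr "\<^bold>\<and>" 35) where
  "(p \<^bold>\<and> q) = (\<^bold>\<not> (p \<^bold>\<longrightarrow> \<^bold>\<not> q))"

definition or_l :: "lfm \<Rightarrow> lfm \<Rightarrow> lfm" (infixr "\<^bold>\<or>" 30) where
  "(p \<^bold>\<or> q) = (\<^bold>\<not> p \<^bold>\<longrightarrow> q)"

definition iff_l :: "lfm \<Rightarrow> lfm \<Rightarrow> lfm" (infixr "\<^bold>\<longleftrightarrow>" 25) where
  "(p \<^bold>\<longleftrightarrow> q) = ((p \<^bold>\<longrightarrow> q) \<^bold>\<and> (q \<^bold>\<longrightarrow> p))"

definition all_l :: "(nat \<Rightarrow> lfm) \<Rightarrow> lfm" (binder "\<^bold>\<forall>" 10) where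
  "(\<^bold>\<forall>x. P x) = (\<lambda>d. All (P d (Suc d)))"

definition ex_l :: "(nat \<Rightarrow> lfm) \<Rightarrow> lfm" (binder "\<^bold>\<exists>" 10) where
  "(\<^bold>\<exists>x. P x) = (\<^bold>\<not> (\<^bold>\<forall>x. \<^bold>\<not> P x))"

text \<open>The formula \<open>p\<close> with its free index \<open>i\<close> replaced by the variable of level \<open>\<rho> i\<close>.\<close>

definition inst_l :: "fm \<Rightarrow> (nat \<Rightarrow> nat) \<Rightarrow> lfm" where
  "inst_l p \<rho> = (\<lambda>d. rename (\<lambda>i. d - Suc (\<rho> i)) p)"


section \<open>Basic notions of set theory\<close>

definition is_subset :: "nat \<Rightarrow> nat \<Rightarrow> lfm" where
  "is_subset x y = (\<^bold>\<forall>z. z \<^bold>\<in> x \<^bold>\<longrightarrow> z \<^bold>\<in> y)"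

definition is_psubset :: "nat \<Rightarrow> nat \<Rightarrow> lfm" where
  "is_psubset x y = (is_subset x y \<^bold>\<and> \<^bold>\<not> x \<^bold>= y)"

definition is_empty :: "nat \<Rightarrow> lfm" where
  "is_empty x = (\<^bold>\<forall>z. \<^bold>\<not> z \<^bold>\<in> x)"

definition is_succ :: "nat \<Rightarrow> nat \<Rightarrow> lfm" where
  "is_succ x y = (\<^bold>\<forall>z. z \<^bold>\<in> y \<^bold>\<longleftrightarrow> z \<^bold>\<in> x \<^bold>\<or> z \<^bold>= x)"

definition is_inductive :: "nat \<Rightarrow> lfm" where
  "is_inductive w =
    ((\<^bold>\<exists>e. is_empty e \<^bold>\<and> e \<^bold>\<in> w) \<^bold>\<and>
     (\<^bold>\<forall>x. x \<^bold>\<in> w \<^bold>\<longrightarrow> (\<^bold>\<exists>y. is_succ x y \<^bold>\<and> y \<^bold>\<in> w)))"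

definition is_omega :: "nat \<Rightarrow> lfm" where
  "is_omega w = (is_inductive w \<^bold>\<and> (\<^bold>\<forall>v. is_inductive v \<^bold>\<longrightarrow> is_subset w v))"

definition is_two :: "nat \<Rightarrow> lfm" where
  "is_two t = (\<^bold>\<exists>e u. is_empty e \<^bold>\<and> is_succ e u \<^bold>\<and> is_succ u t)"

definition is_upair :: "nat \<Rightarrow> nat \<Rightarrow> nat \<Rightarrow> lfm" where
  "is_upair a b p = (\<^bold>\<forall>z. z \<^bold>\<in> p \<^bold>\<longleftrightarrow> z \<^bold>= a \<^bold>\<or> z \<^bold>= b)"

definition is_pair :: "nat \<Rightarrow> nat \<Rightarrow> nat \<Rightarrow> lfm" where
  "is_pair a b p = (\<^bold>\<exists>u v. is_upair a a u \<^bold>\<and> is_upair a b v \<^bold>\<and> is_upair u v p)"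

text \<open>\<open>(x, y) \<in> f\<close>, i.e. \<open>f(x) = y\<close> if \<open>f\<close> is a function and \<open>x\<close> is in its domain.\<close>

definition maps_to :: "nat \<Rightarrow> nat \<Rightarrow> nat \<Rightarrow> lfm" where
  "maps_to f x y = (\<^bold>\<exists>p. is_pair x y p \<^bold>\<and> p \<^bold>\<in> f)"

definition is_function :: "nat \<Rightarrow> nat \<Rightarrow> nat \<Rightarrow> lfm" where
  "is_function f A B =
    ((\<^bold>\<forall>p. p \<^bold>\<in> f \<^bold>\<longrightarrow> (\<^bold>\<exists>x y. x \<^bold>\<in> A \<^bold>\<and> y \<^bold>\<in> B \<^bold>\<and> is_pair x y p)) \<^bold>\<and>
     (\<^bold>\<forall>x. x \<^bold>\<in> A \<^bold>\<longrightarrow> (\<^bold>\<exists>y. maps_to f x y \<^bold>\<and> (\<^bold>\<forall>z. maps_to f x z \<^bold>\<longrightarrow> z \<^bold>= y))))"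

definition is_injection :: "nat \<Rightarrow> nat \<Rightarrow> nat \<Rightarrow> lfm" where
  "is_injection f A B =
    (is_function f A B \<^bold>\<and> (\<^bold>\<forall>x y z. maps_to f x z \<^bold>\<and> maps_to f y z \<^bold>\<longrightarrow> x \<^bold>= y))"

definition is_bijection :: "nat \<Rightarrow> nat \<Rightarrow> nat \<Rightarrow> lfm" where
  "is_bijection f A B =
    (is_injection f A B \<^bold>\<and> (\<^bold>\<forall>y. y \<^bold>\<in> B \<^bold>\<longrightarrow> (\<^bold>\<exists>x. maps_to f x y)))"

text \<open>\<open>S\<close> is the set \<open>B\<^sup>A\<close> of all functions from \<open>A\<close> to \<open>B\<close>.\<close>

definition is_funspace :: "nat \<Rightarrow> nat \<Rightarrow> nat \<Rightarrow> lfm" where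
  "is_funspace A B S = (\<^bold>\<forall>f. f \<^bold>\<in> S \<^bold>\<longleftrightarrow> is_function f A B)"

definition is_countably_infinite :: "nat \<Rightarrow> lfm" where
  "is_countably_infinite X = (\<^bold>\<exists>w f. is_omega w \<^bold>\<and> is_bijection f w X)"


section \<open>The axioms of ZF\<close>

definition extensionality_axiom :: fm where
  "extensionality_axiom = (\<^bold>\<forall>x y. (\<^bold>\<forall>z. z \<^bold>\<in> x \<^bold>\<longleftrightarrow> z \<^bold>\<in> y) \<^bold>\<longrightarrow> x \<^bold>= y) 0"

definition foundation_axiom :: fm where
  "foundation_axiom =
    (\<^bold>\<forall>x. (\<^bold>\<exists>y. y \<^bold>\<in> x) \<^bold>\<longrightarrow> (\<^bold>\<exists>y. y \<^bold>\<in> x \<^bold>\<and> \<^bold>\<not> (\<^bold>\<exists>z. z \<^bold>\<in> x \<^bold>\<and> z \<^bold>\<in> y))) 0"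

definition pairing_axiom :: fm where
  "pairing_axiom = (\<^bold>\<forall>x y. \<^bold>\<exists>z. is_upair x y z) 0"

definition union_axiom :: fm where
  "union_axiom = (\<^bold>\<forall>x. \<^bold>\<exists>u. \<^bold>\<forall>z. z \<^bold>\<in> u \<^bold>\<longleftrightarrow> (\<^bold>\<exists>y. z \<^bold>\<in> y \<^bold>\<and> y \<^bold>\<in> x)) 0"

definition powerset_axiom :: fm where
  "powerset_axiom = (\<^bold>\<forall>x. \<^bold>\<exists>u. \<^bold>\<forall>z. z \<^bold>\<in> u \<^bold>\<longleftrightarrow> is_subset z x) 0"

definition infinity_axiom :: fm where
  "infinity_axiom = (\<^bold>\<exists>w. is_inductive w) 0"

text \<open>
  In the schemas, \<open>n\<close> is the number of parameters, which have the levels \<open>0, \<dots>, n - 1\<close>. The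
  free variables of \<open>p\<close> with index less than \<open>n\<close> stand for the parameters; index \<open>n\<close> stands for
  \<open>x\<close>, and in the replacement schema index \<open>Suc n\<close> stands for \<open>y\<close>.
\<close>

definition separation_axiom :: "nat \<Rightarrow> fm \<Rightarrow> fm" where
  "separation_axiom n p =
    (All ^^ n) ((\<^bold>\<forall>a. \<^bold>\<exists>b. \<^bold>\<forall>x. x \<^bold>\<in> b \<^bold>\<longleftrightarrow> x \<^bold>\<in> a \<^bold>\<and> inst_l p (id(n := x))) n)"

definition replacement_axiom :: "nat \<Rightarrow> fm \<Rightarrow> fm" where
  "replacement_axiom n p =
    (let P = (\<lambda>x y. inst_l p (id(n := x, Suc n := y))) in
     (All ^^ n)
      ((\<^bold>\<forall>a. (\<^bold>\<forall>x. x \<^bold>\<in> a \<^bold>\<longrightarrow> (\<^bold>\<forall>y z. P x y \<^bold>\<and> P x z \<^bold>\<longrightarrow> y \<^bold>= z)) \<^bold>\<longrightarrow>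
             (\<^bold>\<exists>b. \<^bold>\<forall>y. y \<^bold>\<in> b \<^bold>\<longleftrightarrow> (\<^bold>\<exists>x. x \<^bold>\<in> a \<^bold>\<and> P x y))) n))"

definition ZF :: "fm set" where
  "ZF = {extensionality_axiom, foundation_axiom, pairing_axiom, union_axiom, powerset_axiom, infinity_axiom}
        \<union> {separation_axiom n p | n p. fv p \<subseteq> {..n}}
        \<union> {replacement_axiom n p | n p. fv p \<subseteq> {..Suc n}}"


section \<open>Clones\<close>

definition is_arity :: "nat \<Rightarrow> lfm" where
  "is_arity n = (\<^bold>\<exists>w. is_omega w \<^bold>\<and> n \<^bold>\<in> w \<^bold>\<and> \<^bold>\<not> is_empty n)"

text \<open>
  \<open>X\<^sup>n\<close> is the set of functions from the von Neumann natural number \<open>n = {0, \<dots>, n - 1}\<close> to \<open>X\<close>.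
\<close>

definition is_operation_of_arity :: "nat \<Rightarrow> nat \<Rightarrow> nat \<Rightarrow> lfm" where
  "is_operation_of_arity X n f = (\<^bold>\<exists>Xn. is_funspace n X Xn \<^bold>\<and> is_function f Xn X)"

definition is_operation :: "nat \<Rightarrow> nat \<Rightarrow> lfm" where
  "is_operation X f = (\<^bold>\<exists>n. is_arity n \<^bold>\<and> is_operation_of_arity X n f)"

text \<open>\<open>A\<close> is the set of all finitary operations on \<open>X\<close>.\<close>

definition is_all_operations :: "nat \<Rightarrow> nat \<Rightarrow> lfm" where
  "is_all_operations X A = (\<^bold>\<forall>f. f \<^bold>\<in> A \<^bold>\<longleftrightarrow> is_operation X f)"

definition is_projection :: "nat \<Rightarrow> nat \<Rightarrow> lfm" where
  "is_projection X f =
    (\<^bold>\<exists>n i Xn. is_arity n \<^bold>\<and> i \<^bold>\<in> n \<^bold>\<and> is_funspace n X Xn \<^bold>\<and> is_function f Xn X \<^bold>\<and>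
       (\<^bold>\<forall>a. a \<^bold>\<in> Xn \<^bold>\<longrightarrow> (\<^bold>\<exists>y. maps_to a i y \<^bold>\<and> maps_to f a y)))"

text \<open>
  \<open>h\<close> is the \<open>m\<close>-ary operation \<open>f(g\<^sub>0, \<dots>, g\<^bsub>n-1\<^esub>)\<close>, where \<open>f\<close> is \<open>n\<close>-ary and \<open>g\<close> is an
  \<open>n\<close>-tuple of \<open>m\<close>-ary operations; \<open>b\<close> is the tuple \<open>(g\<^sub>0(a), \<dots>, g\<^bsub>n-1\<^esub>(a))\<close>.
\<close>

definition is_composite :: "nat \<Rightarrow> nat \<Rightarrow> nat \<Rightarrow> nat \<Rightarrow> nat \<Rightarrow> nat \<Rightarrow> lfm" where
  "is_composite X n m f g h =
    (\<^bold>\<exists>Xn Xm. is_funspace n X Xn \<^bold>\<and> is_funspace m X Xm \<^bold>\<and> is_function h Xm X \<^bold>\<and>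
       (\<^bold>\<forall>a. a \<^bold>\<in> Xm \<^bold>\<longrightarrow>
          (\<^bold>\<exists>b y. b \<^bold>\<in> Xn \<^bold>\<and>
             (\<^bold>\<forall>i. i \<^bold>\<in> n \<^bold>\<longrightarrow> (\<^bold>\<exists>k z. maps_to g i k \<^bold>\<and> maps_to k a z \<^bold>\<and> maps_to b i z)) \<^bold>\<and>
             maps_to f b y \<^bold>\<and> maps_to h a y)))"

definition is_clone :: "nat \<Rightarrow> nat \<Rightarrow> lfm" where
  "is_clone X C =
    ((\<^bold>\<forall>f. f \<^bold>\<in> C \<^bold>\<longrightarrow> is_operation X f) \<^bold>\<and>
     (\<^bold>\<forall>f. is_projection X f \<^bold>\<longrightarrow> f \<^bold>\<in> C) \<^bold>\<and>
     (\<^bold>\<forall>n m f g h.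
        is_arity n \<^bold>\<and> is_arity m \<^bold>\<and>
        f \<^bold>\<in> C \<^bold>\<and> is_operation_of_arity X n f \<^bold>\<and>
        is_function g n C \<^bold>\<and> (\<^bold>\<forall>i k. maps_to g i k \<^bold>\<longrightarrow> is_operation_of_arity X m k) \<^bold>\<and>
        is_composite X n m f g h \<^bold>\<longrightarrow> h \<^bold>\<in> C))"

definition is_precomplete_clone :: "nat \<Rightarrow> nat \<Rightarrow> lfm" where
  "is_precomplete_clone X C =
    (\<^bold>\<exists>A. is_all_operations X A \<^bold>\<and> is_clone X C \<^bold>\<and> \<^bold>\<not> C \<^bold>= A \<^bold>\<and>
       \<^bold>\<not> (\<^bold>\<exists>D. is_clone X D \<^bold>\<and> is_psubset C D \<^bold>\<and> is_psubset D A))"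

text \<open>Here \<open>R\<close> is \<open>2\<^sup>\<omega>\<close>, \<open>S\<close> is the set of functions from \<open>2\<^sup>\<omega>\<close> to \<open>2 = {0, 1}\<close>.\<close>

definition many_precomplete_clones :: fm where
  "many_precomplete_clones =
    (\<^bold>\<forall>X. is_countably_infinite X \<^bold>\<longrightarrow>
       (\<^bold>\<exists>w t R S P F.
          is_omega w \<^bold>\<and> is_two t \<^bold>\<and> is_funspace w t R \<^bold>\<and> is_funspace R t S \<^bold>\<and>
          (\<^bold>\<forall>C. C \<^bold>\<in> P \<^bold>\<longleftrightarrow> is_precomplete_clone X C) \<^bold>\<and>
          is_injection F S P)) 0"

end

theory Submission
  imports Defs "HOL-Library.Countable" "HOL-Library.Infinite_Set"
begin

text \<open>
  The derivation is obtained through Goedel's completeness theorem: a formula is derivable from ZF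
  as soon as it holds in every model of ZF (\<open>ZF_derivable\<close>). It then remains to carry out the
  mathematical argument inside an arbitrary model \<open>(E, =)\<close>, whose elements are objects of HOL. The
  choice operator of HOL is harmless there: HOL only reasons \<^emph>\<open>about\<close> the model, and an
  object of the model is only ever obtained from its axioms. The price is that separation is available
  only for predicates that are first-order definable with parameters; a collection of
  introduction rules makes this check automatic.

  The usual proof for countably infinite \<open>X\<close> takes the functions preserving a maximal ideal,
  which would need ultrafilters. Without choice, other ideals do the job. Let \<open>\<B>\<close> be a nonempty family
  of infinite subsets of \<open>X\<close>, and let \<open>I\<close> be the ideal of the sets that have finite intersection
  with every member of \<open>\<B>\<close>. If \<open>A \<notin> I\<close>, then \<open>A \<inter> b\<close> is infinite for some \<open>b \<in> \<B>\<close>, and \<open>A \<inter> b\<close>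
  meets every member of \<open>I\<close> in a finite set. So a unary operation \<open>u\<close> that maps \<open>A \<inter> b\<close> onto \<open>X\<close> and
  everything outside \<open>b\<close> to one point maps all members of \<open>I\<close> to finite sets, and in particular
  preserves \<open>I\<close> (\<open>stretch\<close>). This makes the clone of the operations preserving \<open>I\<close> precomplete
  (\<open>clone_above_ideal_clone\<close>): if \<open>h\<close> is not in it, then \<open>h\<close> maps tuples with entries in members of
  \<open>I\<close> onto a set outside \<open>I\<close>, so \<open>u(h(k\<^sub>0(z), \<dots>, k\<^bsub>n-1\<^esub>(z))) = z\<close> for some functions \<open>k\<^sub>i\<close> with range
  in \<open>I\<close>. An arbitrary operation \<open>g\<close> equals \<open>u(h(k\<^sub>0 \<circ> g, \<dots>, k\<^bsub>n-1\<^esub> \<circ> g))\<close>, and the operations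
  \<open>k\<^sub>i \<circ> g\<close> preserve \<open>I\<close> because their ranges are in \<open>I\<close>.

  To get many ideals, fix two disjoint copies of the binary tree \<open>2\<^bsup><\<omega>\<^esup>\<close> whose nodes are coded by
  elements of \<open>X\<close>. A pair \<open>(x, i)\<close> of \<open>x \<in> 2\<^sup>\<omega>\<close> and \<open>i < 2\<close> gives the branch of \<open>x\<close> in the \<open>i\<close>-th copy, and
  different branches have finite intersection (\<open>almost_disjoint_branches\<close>). A function
  \<open>s : 2\<^sup>\<omega> \<rightarrow> 2\<close> selects the family of the branches \<open>(x, s(x))\<close>. If \<open>s(x) = i \<noteq> s'(x)\<close>, the operation
  that stretches the branch \<open>(x, i)\<close> to all of \<open>X\<close> preserves the ideal of \<open>s\<close> but not that of \<open>s'\<close>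
  (\<open>separating_operation\<close>). So the clones of different functions \<open>s\<close> are different.

  Two choices keep the work inside the model short. Infinity of a subset of \<open>X\<close> is
  expressed by a map from it onto \<open>X\<close> (\<open>large\<close>), the form in which the argument applies it. And preservation
  is formulated for \<open>X\<close>-indexed families of tuples rather than for sets of tuples; this makes
  it possible to find the functions \<open>k\<^sub>i\<close> by choosing elements of the well-ordered set \<open>X\<close> instead of
  elements of \<open>X\<^sup>n\<close>.
\<close>

section \<open>Renaming variables in derivations\<close>

lemma rename_comp: "rename r (rename r' p) = rename (r \<circ> r') p"
proof (induction p arbitrary: r r')
  case (All p)
  have "case_nat 0 (\<lambda>n. Suc (r n)) \<circ> case_nat 0 (\<lambda>n. Suc (r' n)) = case_nat 0 (\<lambda>n. Suc ((r \<circ> r') n))"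
    by (auto simp: fun_eq_iff split: nat.split)
  then show ?case by (simp add: All del: comp_apply)
qed auto

lemma rename_cong: "(\<And>n. n \<in> fv p \<Longrightarrow> r n = r' n) \<Longrightarrow> rename r p = rename r' p"
proof (induction p arbitrary: r r')
  case (All p)
  show ?case
    by (simp, rule All.IH) (use All.prems in \<open>auto split: nat.split\<close>)
next
  case (Imp p q)
  show ?case by (simp, intro conjI Imp.IH) (use Imp.prems in auto)
qed auto

lemma rename_id: "rename (\<lambda>n. n) p = p"
proof (induction p)
  case (All p)
  have "case_nat 0 Suc = (\<lambda>n. n)" by (auto simp: fun_eq_iff split: nat.split)
  then show ?case using All by simp
qed auto

lemma fv_rename: "fv (rename r p) = r ` fv p"
proof (induction p arbitrary: r)
  case (All p)
  have "Suc x \<in> case_nat 0 (\<lambda>n. Suc (r n)) ` fv p \<longleftrightarrow> x \<in> r ` {n. Suc n \<in> fv p}" for x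
  proof
    assume "Suc x \<in> case_nat 0 (\<lambda>n. Suc (r n)) ` fv p"
    then obtain m where "m \<in> fv p" "Suc x = case_nat 0 (\<lambda>n. Suc (r n)) m" by auto
    then show "x \<in> r ` {n. Suc n \<in> fv p}" by (cases m) auto
  qed force
  then show ?case using All by auto
qed auto

lemma finite_fv: "finite (fv p)"
proof (induction p)
  case (All p)
  have "{n. Suc n \<in> fv p} = Suc -` fv p" by auto
  then show ?case using All by (simp add: finite_vimageI)
qed auto

lemma rename_subst: "rename r (subst p x) = subst (rename (case_nat 0 (\<lambda>n. Suc (r n))) p) (r x)"
  unfolding rename_comp
  by (rule arg_cong[where f = "\<lambda>s. rename s p"]) (auto simp: fun_eq_iff split: nat.split)

lemma rename_lift: "rename (case_nat 0 (\<lambda>n. Suc (r n))) (lift p) = lift (rename r p)"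
  unfolding rename_comp
  by (rule arg_cong[where f = "\<lambda>s. rename s p"]) (auto simp: fun_eq_iff split: nat.split)

lemma weaken: "\<Gamma> \<turnstile> p \<Longrightarrow> \<Gamma> \<subseteq> \<Delta> \<Longrightarrow> \<Delta> \<turnstile> p"
proof (induction arbitrary: \<Delta> rule: derivable.induct)
  case (ImpI p \<Gamma> q)
  then show ?case by (meson derivable.ImpI insert_mono)
next
  case (Raa p \<Gamma>)
  then show ?case by (meson derivable.Raa insert_mono)
next
  case (AllI \<Gamma> p)
  then show ?case by (meson derivable.AllI image_mono)
next
  case (EqSubst \<Gamma> x y p)
  then show ?case by (blast intro: derivable.EqSubst[of _ x y p])
qed (auto intro: derivable.intros)

text \<open>
Derivability is invariant under arbitrary, even non-injective, renamings. With a renaming that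
sends a fresh variable to \<open>0\<close> and shifts all others, this turns a derivation about a fresh variable
into a premise of the rule for the universal quantifier.
\<close>

lemma derivable_rename: "\<Gamma> \<turnstile> p \<Longrightarrow> rename r ` \<Gamma> \<turnstile> rename r p"
proof (induction arbitrary: r rule: derivable.induct)
  case (AllI \<Gamma> p)
  from AllI.IH[of "case_nat 0 (\<lambda>n. Suc (r n))"]
  show ?case by (auto intro!: derivable.AllI simp: image_image rename_lift)
next
  case (AllE \<Gamma> p x)
  then show ?case unfolding rename_subst by (auto intro: derivable.AllE)
next
  case (EqSubst \<Gamma> x y p)
  then show ?case unfolding rename_subst by (auto intro: derivable.EqSubst)
qed (auto intro: derivable.intros)

text \<open>
Compactness; it makes the union of the increasing consistent sets below consistent.
\<close>

lemma derivable_finite: "\<Gamma> \<turnstile> p \<Longrightarrow> \<exists>\<Delta>. finite \<Delta> \<and> \<Delta> \<subseteq> \<Gamma> \<and> \<Delta> \<turnstile> p"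
proof (induction rule: derivable.induct)
  case (Assm p \<Gamma>)
  then show ?case by (intro exI[of _ "{p}"]) (auto intro: derivable.Assm)
next
  case (ImpI p \<Gamma> q)
  then obtain \<Delta> where "finite \<Delta>" "\<Delta> \<subseteq> insert p \<Gamma>" "\<Delta> \<turnstile> q" by auto
  then show ?case
    by (intro exI[of _ "\<Delta> - {p}"]) (auto intro!: derivable.ImpI elim: weaken)
next
  case (ImpE \<Gamma> p q)
  then obtain \<Delta> \<Delta>' where "finite \<Delta>" "\<Delta> \<subseteq> \<Gamma>" "\<Delta> \<turnstile> Imp p q" "finite \<Delta>'" "\<Delta>' \<subseteq> \<Gamma>" "\<Delta>' \<turnstile> p" by auto
  then show ?case
    by (intro exI[of _ "\<Delta> \<union> \<Delta>'"]) (auto intro!: derivable.ImpE[of _ p q] elim: weaken)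
next
  case (Raa p \<Gamma>)
  then obtain \<Delta> where "finite \<Delta>" "\<Delta> \<subseteq> insert (Imp p Falsum) \<Gamma>" "\<Delta> \<turnstile> Falsum" by auto
  then show ?case
    by (intro exI[of _ "\<Delta> - {Imp p Falsum}"]) (auto intro!: derivable.Raa[of p] elim: weaken)
next
  case (AllI \<Gamma> p)
  then obtain \<Delta> where "finite \<Delta>" "\<Delta> \<subseteq> lift ` \<Gamma>" "\<Delta> \<turnstile> p" by auto
  then show ?case by (metis derivable.AllI finite_subset_image)
next
  case (AllE \<Gamma> p x)
  then obtain \<Delta> where "finite \<Delta>" "\<Delta> \<subseteq> \<Gamma>" "\<Delta> \<turnstile> All p" by auto
  then show ?case by (blast intro: derivable.AllE[of _ p x])
next
  case (EqRefl \<Gamma> x)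
  then show ?case by (meson derivable.EqRefl finite.emptyI empty_subsetI)
next
  case (EqSubst \<Gamma> x y p)
  then obtain \<Delta> \<Delta>' where "finite \<Delta>" "\<Delta> \<subseteq> \<Gamma>" "\<Delta> \<turnstile> Eq x y" "finite \<Delta>'" "\<Delta>' \<subseteq> \<Gamma>" "\<Delta>' \<turnstile> subst p x" by auto
  then show ?case
    by (intro exI[of _ "\<Delta> \<union> \<Delta>'"]) (auto intro!: derivable.EqSubst[of _ x y p] elim: weaken)
qed

section \<open>Completeness of the calculus\<close>

definition consistent :: "fm set \<Rightarrow> bool" where
  "consistent \<Delta> = (\<not> \<Delta> \<turnstile> Falsum)"

lemma not_derivable_consistent: "\<not> \<Gamma> \<turnstile> p \<Longrightarrow> consistent (insert (Imp p Falsum) \<Gamma>)"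
  unfolding consistent_def by (blast intro: Raa)

lemma generalize_fresh:
  assumes d: "\<Delta> \<turnstile> subst q x" and fresh: "\<And>p. p \<in> \<Delta> \<Longrightarrow> x \<notin> fv p" "x \<notin> fv (All q)"
  shows "\<Delta> \<turnstile> All q"
proof -
  define r where "r n = (if n = x then 0 else Suc n)" for n
  have "rename r p = lift p" if "p \<in> \<Delta>" for p
    by (rule rename_cong) (use fresh(1)[OF that] in \<open>auto simp: r_def\<close>)
  then have 1: "rename r ` \<Delta> = lift ` \<Delta>" by simp
  have "rename r (subst q x) = rename (\<lambda>n. n) q"
    unfolding rename_comp
    by (rule rename_cong) (use fresh(2) in \<open>auto simp: r_def split: nat.split\<close>)
  then show ?thesis
    using derivable_rename[OF d, of r] 1 by (auto intro: AllI simp: rename_id)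
qed

lemma consistent_witness:
  assumes c: "consistent \<Delta>" and q: "Imp (All q) Falsum \<in> \<Delta>"
    and fresh: "\<And>p. p \<in> \<Delta> \<Longrightarrow> x \<notin> fv p"
  shows "consistent (insert (Imp (subst q x) Falsum) \<Delta>)"
proof (rule not_derivable_consistent, rule)
  assume "\<Delta> \<turnstile> subst q x"
  then have "\<Delta> \<turnstile> All q" by (rule generalize_fresh) (use fresh fresh[OF q] in auto)
  then show False using c Assm[OF q] ImpE unfolding consistent_def by blast
qed

definition fresh_for :: "fm set \<Rightarrow> nat" where
  "fresh_for \<Delta> = (SOME x. \<forall>p\<in>\<Delta>. x \<notin> fv p)"

instance fm :: countable
  by countable_datatype

text \<open>
The Henkin construction. Formulas are decided one after the other, and every negated universal
formula that is added gets a counterexample. No new constants are needed as witnesses: variables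
are the only terms, and at each stage only finitely many of them occur free.
\<close>

primrec henkin :: "fm set \<Rightarrow> nat \<Rightarrow> fm set" where
  "henkin \<Gamma> 0 = \<Gamma>"
| "henkin \<Gamma> (Suc n) =
    (let p = from_nat n; \<Delta> = insert p (henkin \<Gamma> n) in
     if \<not> consistent \<Delta> then henkin \<Gamma> n
     else case p of
       Imp (All q) Falsum \<Rightarrow> insert (Imp (subst q (fresh_for \<Delta>)) Falsum) \<Delta>
     | _ \<Rightarrow> \<Delta>)"

lemma henkin_step:
  fixes n defines "p \<equiv> from_nat n"
  shows "henkin \<Gamma> (Suc n) = henkin \<Gamma> n \<and> \<not> consistent (insert p (henkin \<Gamma> n)) \<or>
   consistent (insert p (henkin \<Gamma> n)) \<and>
     ((\<exists>q. p = Imp (All q) Falsum \<and> henkin \<Gamma> (Suc n) = insert (Imp (subst q (fresh_for (insert p (henkin \<Gamma> n)))) Falsum) (insert p (henkin \<Gamma> n))) \<or>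
      (\<nexists>q. p = Imp (All q) Falsum) \<and> henkin \<Gamma> (Suc n) = insert p (henkin \<Gamma> n))"
  unfolding p_def by (auto simp: Let_def split: fm.split)

lemma finite_free_henkin:
  assumes "finite (\<Union> (fv ` \<Gamma>))"
  shows "finite (\<Union> (fv ` henkin \<Gamma> n))"
proof (induction n)
  case (Suc n)
  from henkin_step[of \<Gamma> n] show ?case using Suc finite_fv
    by (elim disjE conjE exE) (simp_all del: henkin.simps fv.simps)
qed (use assms in simp)

lemma fresh_for:
  assumes "finite (\<Union> (fv ` \<Delta>))" "p \<in> \<Delta>"
  shows "fresh_for \<Delta> \<notin> fv p"
proof -
  obtain x where "x \<notin> \<Union> (fv ` \<Delta>)" using ex_new_if_finite[OF infinite_UNIV_nat assms(1)] by auto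
  then have "\<forall>p\<in>\<Delta>. x \<notin> fv p" by auto
  then have "\<forall>p\<in>\<Delta>. fresh_for \<Delta> \<notin> fv p" unfolding fresh_for_def by (rule someI)
  then show ?thesis using assms(2) by blast
qed

lemma consistent_henkin:
  assumes "finite (\<Union> (fv ` \<Gamma>))" "consistent \<Gamma>"
  shows "consistent (henkin \<Gamma> n)"
proof (induction n)
  case (Suc n)
  let ?\<Delta> = "insert (from_nat n) (henkin \<Gamma> n)"
  have "finite (\<Union> (fv ` ?\<Delta>))" using finite_free_henkin[OF assms(1)] finite_fv by simp
  then have "consistent (insert (Imp (subst q (fresh_for ?\<Delta>)) Falsum) ?\<Delta>)"
    if "consistent ?\<Delta>" "from_nat n = Imp (All q) Falsum" for q
    by (intro consistent_witness fresh_for) (use that in auto)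
  with henkin_step[of \<Gamma> n] show ?case using Suc by metis
qed (use assms in simp)

lemma henkin_mono: "m \<le> n \<Longrightarrow> henkin \<Gamma> m \<subseteq> henkin \<Gamma> n"
proof (induction n rule: dec_induct)
  case (step n)
  from henkin_step[of \<Gamma> n] step show ?case by blast
qed simp

lemma henkin_extension:
  assumes fin: "finite (\<Union> (fv ` \<Gamma>))" and con: "consistent \<Gamma>"
  obtains H where "\<Gamma> \<subseteq> H" "consistent H"
    "\<And>p. p \<notin> H \<Longrightarrow> \<not> consistent (insert p H)"
    "\<And>q. Imp (All q) Falsum \<in> H \<Longrightarrow> \<exists>x. Imp (subst q x) Falsum \<in> H"
proof
  define H where "H = (\<Union>n. henkin \<Gamma> n)"
  have sub: "henkin \<Gamma> n \<subseteq> H" for n unfolding H_def by auto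
  show "\<Gamma> \<subseteq> H" using sub[of 0] by simp
  have fs: "\<exists>n. \<Delta> \<subseteq> henkin \<Gamma> n" if "finite \<Delta>" "\<Delta> \<subseteq> H" for \<Delta>
    using that
  proof (induction \<Delta>)
    case (insert p \<Delta>)
    then obtain m n where "\<Delta> \<subseteq> henkin \<Gamma> n" "p \<in> henkin \<Gamma> m" unfolding H_def by auto
    then show ?case using henkin_mono[of n "max m n" \<Gamma>] henkin_mono[of m "max m n" \<Gamma>]
      by (intro exI[of _ "max m n"]) auto
  qed simp
  show cH: "consistent H"
    unfolding consistent_def
  proof
    assume "H \<turnstile> Falsum"
    then obtain \<Delta> n where "\<Delta> \<subseteq> henkin \<Gamma> n" "\<Delta> \<turnstile> Falsum" using derivable_finite fs by metis
    then have "henkin \<Gamma> n \<turnstile> Falsum" using weaken by metis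
    then show False using consistent_henkin[OF fin con] unfolding consistent_def by metis
  qed
  have in1: "p \<in> henkin \<Gamma> (Suc (to_nat p))" if "consistent (insert p H)" for p
  proof -
    have "consistent (insert p (henkin \<Gamma> (to_nat p)))"
      using that sub[of "to_nat p"] weaken unfolding consistent_def by (meson insert_mono)
    then show ?thesis using henkin_step[of \<Gamma> "to_nat p"] by auto
  qed
  show "\<not> consistent (insert p H)" if "p \<notin> H" for p using in1[of p] that sub by blast
  show "\<exists>x. Imp (subst q x) Falsum \<in> H" if "Imp (All q) Falsum \<in> H" for q
  proof -
    let ?p = "Imp (All q) Falsum"
    have "consistent (insert ?p H)" using that cH by (simp add: insert_absorb)
    then have "consistent (insert ?p (henkin \<Gamma> (to_nat ?p)))"
      using sub[of "to_nat ?p"] weaken unfolding consistent_def by (meson insert_mono)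
    then show ?thesis using henkin_step[of \<Gamma> "to_nat ?p"] sub[of "Suc (to_nat ?p)"] by auto
  qed
qed

primrec sat :: "('a \<Rightarrow> 'a \<Rightarrow> bool) \<Rightarrow> ('a \<Rightarrow> 'a \<Rightarrow> bool) \<Rightarrow> (nat \<Rightarrow> 'a) \<Rightarrow> fm \<Rightarrow> bool" where
  "sat M Q e (Mem x y) = M (e x) (e y)"
| "sat M Q e (Eq x y) = Q (e x) (e y)"
| "sat M Q e Falsum = False"
| "sat M Q e (Imp p q) = (sat M Q e p \<longrightarrow> sat M Q e q)"
| "sat M Q e (All p) = (\<forall>a. sat M Q (case_nat a e) p)"

lemma sat_rename: "sat M Q e (rename r p) = sat M Q (e \<circ> r) p"
proof (induction p arbitrary: e r)
  case (All p)
  have "case_nat a e \<circ> case_nat 0 (\<lambda>n. Suc (r n)) = case_nat a (e \<circ> r)" for a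
    by (auto simp: fun_eq_iff split: nat.split)
  then show ?case by (simp add: All del: comp_apply)
qed auto

lemma sat_cong: "(\<And>n. n \<in> fv p \<Longrightarrow> e n = e' n) \<Longrightarrow> sat M Q e p = sat M Q e' p"
proof (induction p arbitrary: e e')
  case (All p)
  have "sat M Q (case_nat a e) p = sat M Q (case_nat a e') p" for a
    by (rule All.IH) (use All.prems in \<open>auto split: nat.split\<close>)
  then show ?case by simp
next
  case (Imp p q)
  have "sat M Q e p = sat M Q e' p" "sat M Q e q = sat M Q e' q"
    by (intro Imp.IH; use Imp.prems in simp)+
  then show ?case by simp
qed auto

text \<open>
A model with a congruence as equality satisfies the same formulas as its quotient, which is given here by
a surjection \<open>g\<close>.
\<close>

lemma sat_surj:
  assumes "surj g" "\<And>x y. M x y = M' (g x) (g y)" "\<And>x y. Q x y = Q' (g x) (g y)"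
  shows "sat M Q e p = sat M' Q' (g \<circ> e) p"
proof (induction p arbitrary: e)
  case (All p)
  have "g \<circ> case_nat a e = case_nat (g a) (g \<circ> e)" for a
    by (auto simp: fun_eq_iff split: nat.split)
  then have "sat M Q e (All p) \<longleftrightarrow> (\<forall>a. sat M' Q' (case_nat (g a) (g \<circ> e)) p)"
    by (simp add: All)
  also have "\<dots> \<longleftrightarrow> sat M' Q' (g \<circ> e) (All p)"
    using assms(1) by (metis sat.simps(5) surjD)
  finally show ?case .
qed (use assms in auto)

text \<open>
The term model: its elements are the variables, and equality is interpreted by the congruence that
\<open>H\<close> asserts, not yet by identity. Generalising the truth lemma over the assignment \<open>r\<close> allows a
structural induction, since an instance \<open>rename (case_nat a r) p\<close> is no subformula
of \<open>All p\<close>.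
\<close>

lemma henkin_model:
  assumes cH: "consistent H"
    and max: "\<And>p. p \<notin> H \<Longrightarrow> \<not> consistent (insert p H)"
    and wit: "\<And>q. Imp (All q) Falsum \<in> H \<Longrightarrow> \<exists>x. Imp (subst q x) Falsum \<in> H"
  shows "sat (\<lambda>x y. Mem x y \<in> H) (\<lambda>x y. Eq x y \<in> H) r p \<longleftrightarrow> rename r p \<in> H"
    and "equivp (\<lambda>x y. Eq x y \<in> H)"
    and "Eq x y \<in> H \<Longrightarrow> Eq x' y' \<in> H \<Longrightarrow> Mem x x' \<in> H \<longleftrightarrow> Mem y y' \<in> H"
proof -
  have ded: "p \<in> H" if "H \<turnstile> p" for p
  proof (rule ccontr)
    assume "p \<notin> H"
    then have "insert p H \<turnstile> Falsum" using max unfolding consistent_def by blast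
    then have "H \<turnstile> Imp p Falsum" by (rule ImpI)
    then show False using ImpE that cH unfolding consistent_def by blast
  qed
  have memI: "p \<in> H \<longleftrightarrow> H \<turnstile> p" for p using ded Assm by blast
  have fal: "Falsum \<notin> H" using cH memI unfolding consistent_def by blast
  have neg: "Imp p Falsum \<in> H \<longleftrightarrow> p \<notin> H" for p
  proof
    show "Imp p Falsum \<in> H \<Longrightarrow> p \<notin> H" using memI ImpE fal by blast
    assume "p \<notin> H"
    then have "insert p H \<turnstile> Falsum" using max unfolding consistent_def by blast
    then show "Imp p Falsum \<in> H" using ImpI memI by blast
  qed
  have imp: "Imp p q \<in> H \<longleftrightarrow> (p \<in> H \<longrightarrow> q \<in> H)" for p q
  proof
    show "Imp p q \<in> H \<Longrightarrow> p \<in> H \<longrightarrow> q \<in> H" using memI ImpE by blast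
    assume a: "p \<in> H \<longrightarrow> q \<in> H"
    show "Imp p q \<in> H"
    proof (cases "p \<in> H")
      case True
      then have "insert p H \<turnstile> q" using a Assm by blast
      then show ?thesis using memI ImpI by blast
    next
      case False
      then have "H \<turnstile> Imp p Falsum" using neg memI by blast
      then have "insert (Imp q Falsum) (insert p H) \<turnstile> Imp p Falsum" by (rule weaken) auto
      moreover have "insert (Imp q Falsum) (insert p H) \<turnstile> p" by (rule Assm) auto
      ultimately have "insert p H \<turnstile> q" by (blast intro: Raa ImpE)
      then show ?thesis using memI ImpI by blast
    qed
  qed
  have all: "All q \<in> H \<longleftrightarrow> (\<forall>x. subst q x \<in> H)" for q
  proof
    show "All q \<in> H \<Longrightarrow> \<forall>x. subst q x \<in> H" using memI AllE by blast
    assume "\<forall>x. subst q x \<in> H"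
    then show "All q \<in> H" using wit[of q] neg by blast
  qed
  have refl: "Eq x x \<in> H" for x using memI EqRefl by blast
  have repl: "subst p y \<in> H" if "Eq x y \<in> H" "subst p x \<in> H" for x y p
    using that memI EqSubst by blast
  have sym: "Eq y x \<in> H" if "Eq x y \<in> H" for x y
    using repl[OF that, of "Eq 0 (Suc x)"] refl by simp
  have trans: "Eq x z \<in> H" if "Eq x y \<in> H" "Eq y z \<in> H" for x y z
    using repl[OF that(2), of "Eq (Suc x) 0"] that by simp
  show "equivp (\<lambda>x y. Eq x y \<in> H)"
    by (rule equivpI) (auto intro!: reflpI sympI transpI refl intro: sym trans)
  have m: "Mem y y' \<in> H" if "Eq x y \<in> H" "Eq x' y' \<in> H" "Mem x x' \<in> H" for x y x' y'
    using repl[OF that(1), of "Mem 0 (Suc x')"] repl[OF that(2), of "Mem (Suc y) 0"] that(3) by simp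
  show "Mem x x' \<in> H \<longleftrightarrow> Mem y y' \<in> H" if "Eq x y \<in> H" "Eq x' y' \<in> H"
    using that m sym by blast
  show "sat (\<lambda>x y. Mem x y \<in> H) (\<lambda>x y. Eq x y \<in> H) r p \<longleftrightarrow> rename r p \<in> H"
  proof (induction p arbitrary: r)
    case (All p)
    have "subst (rename (case_nat 0 (\<lambda>n. Suc (r n))) p) a = rename (case_nat a r) p" for a
      unfolding rename_comp
      by (rule arg_cong[where f = "\<lambda>s. rename s p"]) (auto simp: fun_eq_iff split: nat.split)
    then show ?case using All all by simp
  qed (use fal imp in auto)
qed

text \<open>
Only finitely many variables may be free in \<open>\<Gamma>\<close>, so that infinitely many remain as witnesses.
\<close>

lemma completeness:
  assumes fin: "finite (\<Union> (fv ` \<Gamma>))"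
    and valid: "\<And>(M :: nat \<Rightarrow> nat \<Rightarrow> bool) Q e. equivp Q \<Longrightarrow>
      (\<And>x y x' y'. Q x y \<Longrightarrow> Q x' y' \<Longrightarrow> M x x' \<longleftrightarrow> M y y') \<Longrightarrow>
      (\<And>q. q \<in> \<Gamma> \<Longrightarrow> sat M Q e q) \<Longrightarrow> sat M Q e p"
  shows "\<Gamma> \<turnstile> p"
proof (rule ccontr)
  assume "\<not> \<Gamma> \<turnstile> p"
  then have con: "consistent (insert (Imp p Falsum) \<Gamma>)" by (rule not_derivable_consistent)
  have "finite (\<Union> (fv ` (insert (Imp p Falsum) \<Gamma>)))" using fin finite_fv by simp
  from henkin_extension[OF this con] obtain H where H: "insert (Imp p Falsum) \<Gamma> \<subseteq> H" "consistent H"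
    "\<And>p. p \<notin> H \<Longrightarrow> \<not> consistent (insert p H)"
    "\<And>q. Imp (All q) Falsum \<in> H \<Longrightarrow> \<exists>x. Imp (subst q x) Falsum \<in> H" by blast
  note model = henkin_model[OF H(2,3,4)]
  let ?sat = "sat (\<lambda>x y. Mem x y \<in> H) (\<lambda>x y. Eq x y \<in> H) (\<lambda>n. n)"
  have sat: "?sat q" if "q \<in> H" for q using model(1)[of "\<lambda>n. n" q] that by (simp add: rename_id)
  have "?sat p"
    by (rule valid[OF model(2)]) (use model(3) sat H(1) in blast)+
  moreover have "\<not> ?sat p" using sat[of "Imp p Falsum"] H(1) by auto
  ultimately show False by contradiction
qed

section \<open>Satisfaction of formulas with variable levels\<close>

text \<open>
The value of the variable of level \<open>l\<close> inside \<open>d\<close> quantifiers.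
\<close>

definition lv :: "nat \<Rightarrow> (nat \<Rightarrow> 'a) \<Rightarrow> nat \<Rightarrow> 'a" where
  "lv d e l = e (d - Suc l)"

lemma lv_new [simp]: "lv (Suc d) (case_nat a e) d = a"
  by (simp add: lv_def)

lemma lv_old [simp]: "l < d \<Longrightarrow> lv (Suc d) (case_nat a e) l = lv d e l"
  by (simp add: lv_def split: nat.split) (metis Suc_diff_Suc diff_Suc_1 nat.inject)

lemma sat_l [simp]:
  "sat M Q e ((x \<^bold>\<in> y) d) \<longleftrightarrow> M (lv d e x) (lv d e y)"
  "sat M Q e ((x \<^bold>= y) d) \<longleftrightarrow> Q (lv d e x) (lv d e y)"
  "sat M Q e ((p \<^bold>\<longrightarrow> q) d) \<longleftrightarrow> (sat M Q e (p d) \<longrightarrow> sat M Q e (q d))"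
  "sat M Q e ((\<^bold>\<not> p) d) \<longleftrightarrow> \<not> sat M Q e (p d)"
  "sat M Q e ((p \<^bold>\<and> q) d) \<longleftrightarrow> sat M Q e (p d) \<and> sat M Q e (q d)"
  "sat M Q e ((p \<^bold>\<or> q) d) \<longleftrightarrow> sat M Q e (p d) \<or> sat M Q e (q d)"
  "sat M Q e ((p \<^bold>\<longleftrightarrow> q) d) \<longleftrightarrow> (sat M Q e (p d) \<longleftrightarrow> sat M Q e (q d))"
  "sat M Q e ((\<^bold>\<forall>x. P x) d) \<longleftrightarrow> (\<forall>a. sat M Q (case_nat a e) (P d (Suc d)))"
  "sat M Q e ((\<^bold>\<exists>x. P x) d) \<longleftrightarrow> (\<exists>a. sat M Q (case_nat a e) (P d (Suc d)))"
  by (auto simp: mem_l_def eq_l_def imp_l_def not_l_def and_l_def or_l_def iff_l_def all_l_def ex_l_def lv_def)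

lemma sat_inst_l: "sat M Q e (inst_l p \<rho> d) \<longleftrightarrow> sat M Q (\<lambda>i. lv d e (\<rho> i)) p"
  by (simp add: inst_l_def sat_rename lv_def comp_def)

text \<open>
Instantiation of the parameters of an axiom schema: \<open>e'\<close> assigns arbitrary values to the \<open>n\<close>
quantified variables and continues with \<open>e\<close>.
\<close>

lemma sat_All_pow:
  "sat M Q e ((All ^^ n) q) \<Longrightarrow> (\<And>i. e' (n + i) = e i) \<Longrightarrow> sat M Q e' q"
proof (induction n arbitrary: e)
  case 0
  then have "e' = e" by auto
  then show ?case using 0 by simp
next
  case (Suc n)
  have "e' (n + i) = case_nat (e' n) e i" for i
    using Suc.prems(2) by (auto split: nat.split)
  then show ?case using Suc.IH[of "case_nat (e' n) e"] Suc.prems(1) by simp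
qed

section \<open>Definable predicates and terms\<close>

text \<open>
Even variables are the arguments of a definable predicate, odd variables its parameters. So both
are unlimited in number, and the parameters never get in the way of the arguments.
\<close>

definition mix :: "(nat \<Rightarrow> 'a) \<Rightarrow> (nat \<Rightarrow> 'a) \<Rightarrow> nat \<Rightarrow> 'a" where
  "mix e c i = (if even i then e (i div 2) else c (i div 2))"

named_theorems definability

locale mem_rel =
  fixes E :: "'a \<Rightarrow> 'a \<Rightarrow> bool" (infix "\<epsilon>" 50)
begin

abbreviation satE :: "(nat \<Rightarrow> 'a) \<Rightarrow> fm \<Rightarrow> bool" where
  "satE \<equiv> sat E (=)"

text \<open>
Predicates on the model with several arguments are represented as predicates of an assignment
\<open>e\<close>, with the arguments \<open>e 0\<close>, \<open>e 1\<close>, and so on. Since the arguments are again de Bruijn indices, a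
predicate under a quantifier is definable as a predicate of the extended assignment, and the closure
properties below become introduction rules that higher-order unification can apply.
\<close>

definition definable :: "((nat \<Rightarrow> 'a) \<Rightarrow> bool) \<Rightarrow> bool" where
  "definable P = (\<exists>p c. \<forall>e. P e = satE (mix e c) p)"

definition definable_term :: "((nat \<Rightarrow> 'a) \<Rightarrow> 'a) \<Rightarrow> bool" where
  "definable_term t = definable (\<lambda>e. e 0 = t (\<lambda>n. e (Suc n)))"

lemma definable_ren:
  assumes "definable P" shows "definable (\<lambda>e. P (\<lambda>n. e (f n)))"
proof -
  obtain p c where p: "P e = satE (mix e c) p" for e using assms unfolding definable_def by auto
  define r where "r i = (if even i then 2 * f (i div 2) else i)" for i
  have "mix (\<lambda>n. e (f n)) c = mix e c \<circ> r" for e by (auto simp: mix_def r_def fun_eq_iff)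
  then have "P (\<lambda>n. e (f n)) = satE (mix e c) (rename r p)" for e
    unfolding sat_rename p by simp
  then show ?thesis unfolding definable_def by blast
qed

lemma definable_atom: "definable (\<lambda>e. e m \<epsilon> e n)" "definable (\<lambda>e. e m = e n)" "definable_term (\<lambda>e. e n)"
proof -
  show "definable (\<lambda>e. e m \<epsilon> e n)" unfolding definable_def
    by (rule exI[of _ "Mem (2*m) (2*n)"]) (simp add: mix_def)
  show definable: "definable (\<lambda>e. e m = e n)" for m n unfolding definable_def
    by (rule exI[of _ "Eq (2*m) (2*n)"]) (simp add: mix_def)
  show "definable_term (\<lambda>e. e n)" unfolding definable_term_def by (rule definable)
qed

lemma definable_term_const: "definable_term (\<lambda>e. a)"
  unfolding definable_term_def definable_def
  by (rule exI[of _ "Eq 0 1"], rule exI[of _ "\<lambda>_. a"]) (simp add: mix_def)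

lemma definable_const: "definable (\<lambda>e. b)"
proof (cases b)
  case True
  then show ?thesis unfolding definable_def by (intro exI[of _ "Imp Falsum Falsum"]) auto
next
  case False
  then show ?thesis unfolding definable_def by (intro exI[of _ "Falsum"]) auto
qed

lemma definable_imp:
  assumes "definable P" "definable Q" shows "definable (\<lambda>e. P e \<longrightarrow> Q e)"
proof -
  obtain p c where p: "P e = satE (mix e c) p" for e using assms unfolding definable_def by auto
  obtain q d where q: "Q e = satE (mix e d) q" for e using assms unfolding definable_def by auto
  (* the parameters of both formulas, interleaved once more *)
  define b where "b = mix c d"
  define r where "r i = (if even i then i else 2 * (2 * (i div 2)) + 1)" for i :: nat
  define s where "s i = (if even i then i else 2 * (2 * (i div 2) + 1) + 1)" for i :: nat
  have "mix e c = mix e b \<circ> r" "mix e d = mix e b \<circ> s" for e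
    by (auto simp: fun_eq_iff mix_def r_def s_def b_def elim!: oddE)
  then have "(P e \<longrightarrow> Q e) = satE (mix e b) (Imp (rename r p) (rename s q))" for e
    unfolding p q by (simp add: sat_rename)
  then show ?thesis unfolding definable_def by blast
qed

lemma definable_all:
  assumes "definable (\<lambda>e. Q (e 0) (\<lambda>n. e (Suc n)))" shows "definable (\<lambda>e. \<forall>x. Q x e)"
proof -
  obtain p c where p: "Q (e 0) (\<lambda>n. e (Suc n)) = satE (mix e c) p" for e
    using assms unfolding definable_def by auto
  (* argument 0 becomes the bound variable, argument k + 1 becomes argument k below the quantifier *)
  define r where "r i = (if i = 0 then 0 else if even i then Suc (i - 2) else Suc i)" for i :: nat
  have "case_nat x (mix e c) \<circ> r = mix (case_nat x e) c" for e x
  proof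
    fix i
    show "(case_nat x (mix e c) \<circ> r) i = mix (case_nat x e) c i"
    proof (cases "i = 0 \<or> odd i")
      case False
      then obtain k where "i = 2 * Suc k" by (metis evenE not0_implies_Suc mult_0_right)
      then show ?thesis by (simp add: r_def mix_def)
    qed (auto simp: r_def mix_def)
  qed
  then have "(\<forall>x. Q x e) = satE (mix e c) (All (rename r p))" for e
    using p[of "case_nat x e" for x] by (simp add: sat_rename)
  then show ?thesis unfolding definable_def by blast
qed

lemma definable_not: "definable P \<Longrightarrow> definable (\<lambda>e. \<not> P e)"
  using definable_imp[of P "\<lambda>e. False"] definable_const by simp

lemma definable_or: "definable P \<Longrightarrow> definable Q \<Longrightarrow> definable (\<lambda>e. P e \<or> Q e)"
  using definable_imp[of "\<lambda>e. \<not> P e" Q] definable_not by (simp add: disj_imp)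

lemma definable_and: "definable P \<Longrightarrow> definable Q \<Longrightarrow> definable (\<lambda>e. P e \<and> Q e)"
  using definable_not[OF definable_imp[of P "\<lambda>e. \<not> Q e"]] definable_not by simp

lemma definable_iff: "definable P \<Longrightarrow> definable Q \<Longrightarrow> definable (\<lambda>e. P e = Q e)"
  using definable_and[OF definable_imp[of P Q] definable_imp[of Q P]] by (simp add: iff_conv_conj_imp)

lemma definable_ex:
  assumes "definable (\<lambda>e. Q (e 0) (\<lambda>n. e (Suc n)))" shows "definable (\<lambda>e. \<exists>x. Q x e)"
  using definable_not[OF definable_all[of "\<lambda>x e. \<not> Q x e", OF definable_not[OF assms]]] by simp

lemma definable_subst:
  assumes "definable_term t" "definable (\<lambda>e. Q (e 0) (\<lambda>n. e (Suc n)))"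
  shows "definable (\<lambda>e. Q (t e) e)"
proof -
  have "definable (\<lambda>e. \<exists>x. x = t e \<and> Q x e)"
    by (rule definable_ex, rule definable_and) (use assms in \<open>simp_all add: definable_term_def\<close>)
  then show ?thesis by simp
qed

text \<open>
Substituting terms: \<open>P (t e)\<close> is \<open>\<exists>a. a = t e \<and> P a\<close>, where \<open>t\<close> is evaluated in the original assignment,
i.e. in the extended one without the bound variables. The rules \<open>definable_subst2\<close> to
\<open>definable_subst4\<close> let it suffice to prove a new notion definable for distinct variables as arguments.
\<close>

lemma definable_term_eq: "definable_term t \<Longrightarrow> definable (\<lambda>e. e m = t (\<lambda>n. e (f n)))"
  unfolding definable_term_def using definable_ren[of "\<lambda>e. e 0 = t (\<lambda>n. e (Suc n))" "case_nat m f"] by simp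

lemma definable_subst1:
  assumes "definable (\<lambda>e. P (e 0))" "definable_term t" shows "definable (\<lambda>e. P (t e))"
  using definable_subst[of t "\<lambda>x e. P x"] assms by simp

lemma definable_subst2:
  assumes "definable (\<lambda>e. P (e 0) (e 1))" "definable_term t" "definable_term u" shows "definable (\<lambda>e. P (t e) (u e))"
proof -
  have "definable (\<lambda>e. \<exists>a b. a = t e \<and> b = u e \<and> P a b)"
    using definable_term_eq[OF assms(2), of 1 "\<lambda>n. Suc (Suc n)"] definable_term_eq[OF assms(3), of 0 "\<lambda>n. Suc (Suc n)"]
      definable_ren[OF assms(1), of "case_nat 1 (\<lambda>_. 0)"]
    by (intro definable_ex definable_and) (simp_all add: eval_nat_numeral)
  then show ?thesis by simp
qed

lemma definable_subst3:
  assumes "definable (\<lambda>e. P (e 0) (e 1) (e 2))" "definable_term t" "definable_term u" "definable_term v" shows "definable (\<lambda>e. P (t e) (u e) (v e))"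
proof -
  have "definable (\<lambda>e. \<exists>a b c. a = t e \<and> b = u e \<and> c = v e \<and> P a b c)"
    using definable_term_eq[OF assms(2), of 2 "\<lambda>n. Suc (Suc (Suc n))"] definable_term_eq[OF assms(3), of 1 "\<lambda>n. Suc (Suc (Suc n))"]
      definable_term_eq[OF assms(4), of 0 "\<lambda>n. Suc (Suc (Suc n))"]
      definable_ren[OF assms(1), of "case_nat 2 (case_nat 1 (\<lambda>_. 0))"]
    by (intro definable_ex definable_and) (simp_all add: eval_nat_numeral)
  then show ?thesis by simp
qed

lemma definable_subst4:
  assumes "definable (\<lambda>e. P (e 0) (e 1) (e 2) (e 3))" "definable_term t" "definable_term u" "definable_term v" "definable_term w"
  shows "definable (\<lambda>e. P (t e) (u e) (v e) (w e))"
proof -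
  have "definable (\<lambda>e. \<exists>a b c d. a = t e \<and> b = u e \<and> c = v e \<and> d = w e \<and> P a b c d)"
    using definable_term_eq[OF assms(2), of 3 "\<lambda>n. Suc (Suc (Suc (Suc n)))"]
      definable_term_eq[OF assms(3), of 2 "\<lambda>n. Suc (Suc (Suc (Suc n)))"]
      definable_term_eq[OF assms(4), of 1 "\<lambda>n. Suc (Suc (Suc (Suc n)))"]
      definable_term_eq[OF assms(5), of 0 "\<lambda>n. Suc (Suc (Suc (Suc n)))"]
      definable_ren[OF assms(1), of "case_nat 3 (case_nat 2 (case_nat 1 (\<lambda>_. 0)))"]
    by (intro definable_ex definable_and) (simp_all add: eval_nat_numeral)
  then show ?thesis by simp
qed

lemma definable_term_ren: "definable_term t \<Longrightarrow> definable_term (\<lambda>e. t (\<lambda>n. e (f n)))"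
  unfolding definable_term_def using definable_term_eq[of t 0 "\<lambda>n. Suc (f n)"] by (simp add: definable_term_def)

text \<open>
A function on the model is definable as soon as its graph is.
\<close>

lemma definable_term_relation1:
  assumes "\<And>x z. z = f x \<longleftrightarrow> R x z" "definable (\<lambda>e. R (e 0) (e 1))" "definable_term t"
  shows "definable_term (\<lambda>e. f (t e))"
  unfolding definable_term_def assms(1)
  by (rule definable_subst2[where P = R, OF assms(2) definable_term_ren[OF assms(3)] definable_atom(3)])

lemma definable_term_relation2:
  assumes "\<And>x y z. z = f x y \<longleftrightarrow> R x y z" "definable (\<lambda>e. R (e 0) (e 1) (e 2))" "definable_term t" "definable_term u"
  shows "definable_term (\<lambda>e. f (t e) (u e))"
  unfolding definable_term_def assms(1)
  by (rule definable_subst3[where P = R, OF assms(2) definable_term_ren[OF assms(3)] definable_term_ren[OF assms(4)] definable_atom(3)])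

lemma definable_mem: "definable_term t \<Longrightarrow> definable_term u \<Longrightarrow> definable (\<lambda>e. t e \<epsilon> u e)"
  by (rule definable_subst2[where P = E, OF definable_atom(1)])

lemma definable_eq: "definable_term t \<Longrightarrow> definable_term u \<Longrightarrow> definable (\<lambda>e. t e = u e)"
  by (rule definable_subst2[where P = "(=)", OF definable_atom(2)])

lemmas [definability] = definable_atom(3) definable_term_const definable_const definable_mem definable_eq definable_imp definable_not definable_or definable_and definable_iff definable_all definable_ex

section \<open>The notions of the theorem in a model\<close>

text \<open>
These definitions follow those of the formulas word by word, so that the correspondence with the
formulas is a matter of unfolding. Simpler characterisations are available once the axioms hold.
\<close>

definition sub :: "'a \<Rightarrow> 'a \<Rightarrow> bool" where
  "sub x y = (\<forall>z. z \<epsilon> x \<longrightarrow> z \<epsilon> y)"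

definition emp :: "'a \<Rightarrow> bool" where
  "emp x = (\<forall>z. \<not> z \<epsilon> x)"

definition succ :: "'a \<Rightarrow> 'a \<Rightarrow> bool" where
  "succ x y = (\<forall>z. z \<epsilon> y \<longleftrightarrow> z \<epsilon> x \<or> z = x)"

definition indset :: "'a \<Rightarrow> bool" where
  "indset w = ((\<exists>e. emp e \<and> e \<epsilon> w) \<and> (\<forall>x. x \<epsilon> w \<longrightarrow> (\<exists>y. succ x y \<and> y \<epsilon> w)))"

definition omega :: "'a \<Rightarrow> bool" where
  "omega w = (indset w \<and> (\<forall>v. indset v \<longrightarrow> sub w v))"

definition two :: "'a \<Rightarrow> bool" where
  "two t = (\<exists>e u. emp e \<and> succ e u \<and> succ u t)"

definition upair :: "'a \<Rightarrow> 'a \<Rightarrow> 'a \<Rightarrow> bool" where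
  "upair a b p = (\<forall>z. z \<epsilon> p \<longleftrightarrow> z = a \<or> z = b)"

definition opair :: "'a \<Rightarrow> 'a \<Rightarrow> 'a \<Rightarrow> bool" where
  "opair a b p = (\<exists>u v. upair a a u \<and> upair a b v \<and> upair u v p)"

definition maps :: "'a \<Rightarrow> 'a \<Rightarrow> 'a \<Rightarrow> bool" where
  "maps f x y = (\<exists>p. opair x y p \<and> p \<epsilon> f)"

definition func :: "'a \<Rightarrow> 'a \<Rightarrow> 'a \<Rightarrow> bool" where
  "func f A B =
    ((\<forall>p. p \<epsilon> f \<longrightarrow> (\<exists>x y. x \<epsilon> A \<and> y \<epsilon> B \<and> opair x y p)) \<and>
     (\<forall>x. x \<epsilon> A \<longrightarrow> (\<exists>y. maps f x y \<and> (\<forall>z. maps f x z \<longrightarrow> z = y))))"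

definition injection :: "'a \<Rightarrow> 'a \<Rightarrow> 'a \<Rightarrow> bool" where
  "injection f A B = (func f A B \<and> (\<forall>x y z. maps f x z \<and> maps f y z \<longrightarrow> x = y))"

definition bijection :: "'a \<Rightarrow> 'a \<Rightarrow> 'a \<Rightarrow> bool" where
  "bijection f A B = (injection f A B \<and> (\<forall>y. y \<epsilon> B \<longrightarrow> (\<exists>x. maps f x y)))"

definition funspace :: "'a \<Rightarrow> 'a \<Rightarrow> 'a \<Rightarrow> bool" where
  "funspace A B S = (\<forall>f. f \<epsilon> S \<longleftrightarrow> func f A B)"

definition countably_infinite :: "'a \<Rightarrow> bool" where
  "countably_infinite X = (\<exists>w f. omega w \<and> bijection f w X)"

definition arity :: "'a \<Rightarrow> bool" where
  "arity n = (\<exists>w. omega w \<and> n \<epsilon> w \<and> \<not> emp n)"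

definition op_of_arity :: "'a \<Rightarrow> 'a \<Rightarrow> 'a \<Rightarrow> bool" where
  "op_of_arity X n f = (\<exists>Xn. funspace n X Xn \<and> func f Xn X)"

definition operation :: "'a \<Rightarrow> 'a \<Rightarrow> bool" where
  "operation X f = (\<exists>n. arity n \<and> op_of_arity X n f)"

definition all_operations :: "'a \<Rightarrow> 'a \<Rightarrow> bool" where
  "all_operations X A = (\<forall>f. f \<epsilon> A \<longleftrightarrow> operation X f)"

definition projection :: "'a \<Rightarrow> 'a \<Rightarrow> bool" where
  "projection X f =
    (\<exists>n i Xn. arity n \<and> i \<epsilon> n \<and> funspace n X Xn \<and> func f Xn X \<and>
       (\<forall>a. a \<epsilon> Xn \<longrightarrow> (\<exists>y. maps a i y \<and> maps f a y)))"

definition composite :: "'a \<Rightarrow> 'a \<Rightarrow> 'a \<Rightarrow> 'a \<Rightarrow> 'a \<Rightarrow> 'a \<Rightarrow> bool" where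
  "composite X n m f g h =
    (\<exists>Xn Xm. funspace n X Xn \<and> funspace m X Xm \<and> func h Xm X \<and>
       (\<forall>a. a \<epsilon> Xm \<longrightarrow>
          (\<exists>b y. b \<epsilon> Xn \<and>
             (\<forall>i. i \<epsilon> n \<longrightarrow> (\<exists>k z. maps g i k \<and> maps k a z \<and> maps b i z)) \<and>
             maps f b y \<and> maps h a y)))"

definition clone :: "'a \<Rightarrow> 'a \<Rightarrow> bool" where
  "clone X C =
    ((\<forall>f. f \<epsilon> C \<longrightarrow> operation X f) \<and>
     (\<forall>f. projection X f \<longrightarrow> f \<epsilon> C) \<and>
     (\<forall>n m f g h.
        arity n \<and> arity m \<and>
        f \<epsilon> C \<and> op_of_arity X n f \<and>
        func g n C \<and> (\<forall>i k. maps g i k \<longrightarrow> op_of_arity X m k) \<and>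
        composite X n m f g h \<longrightarrow> h \<epsilon> C))"

definition precomplete :: "'a \<Rightarrow> 'a \<Rightarrow> bool" where
  "precomplete X C =
    (\<exists>A. all_operations X A \<and> clone X C \<and> \<not> C = A \<and>
       \<not> (\<exists>K. clone X K \<and> (sub C K \<and> \<not> C = K) \<and> (sub K A \<and> \<not> K = A)))"

lemma sat_notions [simp]:
  "x < d \<Longrightarrow> y < d \<Longrightarrow> satE e (is_subset x y d) \<longleftrightarrow> sub (lv d e x) (lv d e y)"
  "x < d \<Longrightarrow> satE e (is_empty x d) \<longleftrightarrow> emp (lv d e x)"
  "x < d \<Longrightarrow> y < d \<Longrightarrow> satE e (is_succ x y d) \<longleftrightarrow> succ (lv d e x) (lv d e y)"
  "x < d \<Longrightarrow> y < d \<Longrightarrow> z < d \<Longrightarrow> satE e (is_upair x y z d) \<longleftrightarrow> upair (lv d e x) (lv d e y) (lv d e z)"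
  unfolding is_subset_def sub_def is_empty_def emp_def is_succ_def succ_def is_upair_def upair_def
  by simp_all

lemma sat_inductive [simp]: "x < d \<Longrightarrow> satE e (is_inductive x d) \<longleftrightarrow> indset (lv d e x)"
  unfolding is_inductive_def indset_def by simp

lemma sat_omega_two [simp]:
  "x < d \<Longrightarrow> satE e (is_omega x d) \<longleftrightarrow> omega (lv d e x)"
  "x < d \<Longrightarrow> satE e (is_two x d) \<longleftrightarrow> two (lv d e x)"
  unfolding is_omega_def omega_def is_two_def two_def by simp_all

lemma sat_pair [simp]: "x < d \<Longrightarrow> y < d \<Longrightarrow> z < d \<Longrightarrow>
    satE e (is_pair x y z d) \<longleftrightarrow> opair (lv d e x) (lv d e y) (lv d e z)"
  unfolding is_pair_def opair_def by simp

lemma sat_maps [simp]: "x < d \<Longrightarrow> y < d \<Longrightarrow> z < d \<Longrightarrow>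
    satE e (maps_to x y z d) \<longleftrightarrow> maps (lv d e x) (lv d e y) (lv d e z)"
  unfolding maps_to_def maps_def by simp

lemma sat_func [simp]: "x < d \<Longrightarrow> y < d \<Longrightarrow> z < d \<Longrightarrow>
    satE e (is_function x y z d) \<longleftrightarrow> func (lv d e x) (lv d e y) (lv d e z)"
  unfolding is_function_def func_def by simp

lemma sat_injection [simp]: "x < d \<Longrightarrow> y < d \<Longrightarrow> z < d \<Longrightarrow>
    satE e (is_injection x y z d) \<longleftrightarrow> injection (lv d e x) (lv d e y) (lv d e z)"
  unfolding is_injection_def injection_def by simp

lemma sat_bijection [simp]: "x < d \<Longrightarrow> y < d \<Longrightarrow> z < d \<Longrightarrow>
    satE e (is_bijection x y z d) \<longleftrightarrow> bijection (lv d e x) (lv d e y) (lv d e z)"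
  unfolding is_bijection_def bijection_def by simp

lemma sat_funspace [simp]: "x < d \<Longrightarrow> y < d \<Longrightarrow> z < d \<Longrightarrow>
    satE e (is_funspace x y z d) \<longleftrightarrow> funspace (lv d e x) (lv d e y) (lv d e z)"
  unfolding is_funspace_def funspace_def by simp

lemma sat_countably_infinite [simp]:
  "x < d \<Longrightarrow> satE e (is_countably_infinite x d) \<longleftrightarrow> countably_infinite (lv d e x)"
  unfolding is_countably_infinite_def countably_infinite_def by simp

lemma sat_arity [simp]: "x < d \<Longrightarrow> satE e (is_arity x d) \<longleftrightarrow> arity (lv d e x)"
  unfolding is_arity_def arity_def by simp

lemma sat_op_of_arity [simp]: "x < d \<Longrightarrow> y < d \<Longrightarrow> z < d \<Longrightarrow>
    satE e (is_operation_of_arity x y z d) \<longleftrightarrow> op_of_arity (lv d e x) (lv d e y) (lv d e z)"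
  unfolding is_operation_of_arity_def op_of_arity_def by simp

lemma sat_operation [simp]:
  "x < d \<Longrightarrow> y < d \<Longrightarrow> satE e (is_operation x y d) \<longleftrightarrow> operation (lv d e x) (lv d e y)"
  unfolding is_operation_def operation_def by simp

lemma sat_all_operations [simp]:
  "x < d \<Longrightarrow> y < d \<Longrightarrow> satE e (is_all_operations x y d) \<longleftrightarrow> all_operations (lv d e x) (lv d e y)"
  unfolding is_all_operations_def all_operations_def by simp

lemma sat_projection [simp]:
  "x < d \<Longrightarrow> y < d \<Longrightarrow> satE e (is_projection x y d) \<longleftrightarrow> projection (lv d e x) (lv d e y)"
  unfolding is_projection_def projection_def by simp

lemma sat_composite [simp]:
  "x < d \<Longrightarrow> n < d \<Longrightarrow> m < d \<Longrightarrow> f < d \<Longrightarrow> g < d \<Longrightarrow> h < d \<Longrightarrow> satE e (is_composite x n m f g h d) \<longleftrightarrow>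
    composite (lv d e x) (lv d e n) (lv d e m) (lv d e f) (lv d e g) (lv d e h)"
  unfolding is_composite_def composite_def by simp

lemma sat_clone [simp]: "x < d \<Longrightarrow> y < d \<Longrightarrow> satE e (is_clone x y d) \<longleftrightarrow> clone (lv d e x) (lv d e y)"
  unfolding is_clone_def clone_def by simp

lemma sat_precomplete [simp]:
  "x < d \<Longrightarrow> y < d \<Longrightarrow> satE e (is_precomplete_clone x y d) \<longleftrightarrow> precomplete (lv d e x) (lv d e y)"
  unfolding is_precomplete_clone_def precomplete_def is_psubset_def by simp

lemma sat_many_precomplete_clones:
  "satE e many_precomplete_clones \<longleftrightarrow>
    (\<forall>X. countably_infinite X \<longrightarrow>
       (\<exists>w t R S P F. omega w \<and> two t \<and> funspace w t R \<and> funspace R t S \<and>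
          (\<forall>C. C \<epsilon> P \<longleftrightarrow> precomplete X C) \<and> injection F S P))"
  unfolding many_precomplete_clones_def by simp

lemma definable_sub [definability]: "definable_term x \<Longrightarrow> definable_term y \<Longrightarrow> definable (\<lambda>e. sub (x e) (y e))"
  by (rule definable_subst2[where P = sub], unfold sub_def) (intro definability | assumption)+

lemma definable_emp [definability]: "definable_term x \<Longrightarrow> definable (\<lambda>e. emp (x e))"
  by (rule definable_subst1[where P = emp], unfold emp_def) (intro definability | assumption)+

lemma definable_succ [definability]: "definable_term x \<Longrightarrow> definable_term y \<Longrightarrow> definable (\<lambda>e. succ (x e) (y e))"
  by (rule definable_subst2[where P = succ], unfold succ_def) (intro definability | assumption)+

lemma definable_upair [definability]: "definable_term x \<Longrightarrow> definable_term y \<Longrightarrow> definable_term z \<Longrightarrow> definable (\<lambda>e. upair (x e) (y e) (z e))"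
  by (rule definable_subst3[where P = upair], unfold upair_def) (intro definability | assumption)+

lemma definable_indset [definability]: "definable_term x \<Longrightarrow> definable (\<lambda>e. indset (x e))"
  by (rule definable_subst1[where P = indset], unfold indset_def) (intro definability | assumption)+

lemma definable_omega [definability]: "definable_term x \<Longrightarrow> definable (\<lambda>e. omega (x e))"
  by (rule definable_subst1[where P = omega], unfold omega_def) (intro definability | assumption)+

lemma definable_opair [definability]: "definable_term x \<Longrightarrow> definable_term y \<Longrightarrow> definable_term z \<Longrightarrow> definable (\<lambda>e. opair (x e) (y e) (z e))"
  by (rule definable_subst3[where P = opair], unfold opair_def) (intro definability | assumption)+

lemma definable_maps [definability]: "definable_term x \<Longrightarrow> definable_term y \<Longrightarrow> definable_term z \<Longrightarrow> definable (\<lambda>e. maps (x e) (y e) (z e))"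
  by (rule definable_subst3[where P = maps], unfold maps_def) (intro definability | assumption)+

lemma definable_func [definability]: "definable_term x \<Longrightarrow> definable_term y \<Longrightarrow> definable_term z \<Longrightarrow> definable (\<lambda>e. func (x e) (y e) (z e))"
  by (rule definable_subst3[where P = func], unfold func_def) (intro definability | assumption)+

lemma definable_funspace [definability]: "definable_term x \<Longrightarrow> definable_term y \<Longrightarrow> definable_term z \<Longrightarrow> definable (\<lambda>e. funspace (x e) (y e) (z e))"
  by (rule definable_subst3[where P = funspace], unfold funspace_def) (intro definability | assumption)+

lemma definable_arity [definability]: "definable_term x \<Longrightarrow> definable (\<lambda>e. arity (x e))"
  by (rule definable_subst1[where P = arity], unfold arity_def) (intro definability | assumption)+

lemma definable_op_of_arity [definability]: "definable_term x \<Longrightarrow> definable_term y \<Longrightarrow> definable_term z \<Longrightarrow> definable (\<lambda>e. op_of_arity (x e) (y e) (z e))"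
  by (rule definable_subst3[where P = op_of_arity], unfold op_of_arity_def) (intro definability | assumption)+

lemma definable_operation [definability]: "definable_term x \<Longrightarrow> definable_term y \<Longrightarrow> definable (\<lambda>e. operation (x e) (y e))"
  by (rule definable_subst2[where P = operation], unfold operation_def) (intro definability | assumption)+

lemma definable_precomplete: "definable (\<lambda>e. precomplete X (e 0))"
  unfolding precomplete_def clone_def composite_def projection_def all_operations_def
  by (intro definability)

end

section \<open>Models of ZF\<close>

locale zf = mem_rel +
  assumes ext: "(\<And>z. z \<epsilon> x \<longleftrightarrow> z \<epsilon> y) \<Longrightarrow> x = y"
    and foundation: "y \<epsilon> x \<Longrightarrow> \<exists>y. y \<epsilon> x \<and> \<not> (\<exists>z. z \<epsilon> x \<and> z \<epsilon> y)"
    and pairing: "\<exists>z. upair x y z"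
    and union: "\<exists>u. \<forall>z. z \<epsilon> u \<longleftrightarrow> (\<exists>y. z \<epsilon> y \<and> y \<epsilon> x)"
    and powerset: "\<exists>u. \<forall>z. z \<epsilon> u \<longleftrightarrow> sub z x"
    and infinity: "\<exists>w. indset w"
    and separation: "definable (\<lambda>e. P (e 0)) \<Longrightarrow> \<exists>b. \<forall>x. x \<epsilon> b \<longleftrightarrow> x \<epsilon> a \<and> P x"

lemma ZF_schemas:
  "{extensionality_axiom, foundation_axiom, pairing_axiom, union_axiom, powerset_axiom, infinity_axiom} \<subseteq> ZF"
  "fv p \<subseteq> {..n} \<Longrightarrow> separation_axiom n p \<in> ZF"
  unfolding ZF_def by auto

text \<open>
The axioms of ZF give separation for every definable predicate, with any number of parameters: the
variables of its formula only have to be rearranged to the form that the schema requires.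
\<close>

lemma zf_of_sat:
  assumes sat: "\<And>p. p \<in> ZF \<Longrightarrow> sat E (=) e p"
  shows "zf E"
proof -
  interpret mem_rel E .
  note axs = sat[OF subsetD[OF ZF_schemas(1)]]
  show ?thesis
  proof
    show "x = y" if "\<And>z. E z x \<longleftrightarrow> E z y" for x y
      using axs[of extensionality_axiom] that unfolding extensionality_axiom_def by simp
    show "\<exists>y. E y x \<and> \<not> (\<exists>z. E z x \<and> E z y)" if "E y x" for x y
      using axs[of foundation_axiom] that unfolding foundation_axiom_def by simp blast
    show "\<exists>z. upair x y z" for x y
      using axs[of pairing_axiom] unfolding pairing_axiom_def by simp
    show "\<exists>u. \<forall>z. E z u \<longleftrightarrow> (\<exists>y. E z y \<and> E y x)" for x
      using axs[of union_axiom] unfolding union_axiom_def by simp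
    show "\<exists>u. \<forall>z. E z u \<longleftrightarrow> sub z x" for x
      using axs[of powerset_axiom] unfolding powerset_axiom_def by simp
    show "\<exists>w. indset w"
      using axs[of infinity_axiom] unfolding infinity_axiom_def by simp
    show "\<exists>b. \<forall>x. E x b \<longleftrightarrow> E x a \<and> P x" if "definable (\<lambda>e. P (e 0))" for P a
    proof -
      obtain p c where p: "P (e 0) = satE (mix e c) p" for e using \<open>definable _\<close> unfolding definable_def by auto
      define n where "n = Suc (Max (insert 0 (fv p)))"
      have n: "i < n" if "i \<in> fv p" for i
        using that finite_fv[of p] unfolding n_def by (simp add: less_Suc_eq_le)
      (* all arguments become the element x with index n, parameter j becomes parameter j of the schema *)
      define r where "r i = (if even i then n else i div 2)" for i
      define q where "q = rename r p"
      have "fv q \<subseteq> {..n}" unfolding q_def fv_rename r_def using n by fastforce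
      then have s: "satE e (separation_axiom n q)" using sat ZF_schemas(2) by blast
      (* the schema counts its parameters from the outermost quantifier, an assignment from the innermost *)
      define e' where "e' i = (if i < n then c (n - Suc i) else e (i - n))" for i
      let ?q = "(\<^bold>\<forall>a. \<^bold>\<exists>b. \<^bold>\<forall>x. x \<^bold>\<in> b \<^bold>\<longleftrightarrow> x \<^bold>\<in> a \<^bold>\<and> inst_l q (id(n := x))) n"
      have "satE e' ?q"
        using s unfolding separation_axiom_def by (rule sat_All_pow) (simp add: e'_def)
      moreover have "satE (\<lambda>i. lv (Suc (Suc (Suc n))) (case_nat x (case_nat b (case_nat a' e'))) ((id(n := Suc (Suc n))) i)) q \<longleftrightarrow> P x" for x b a'
      proof -
        have "satE (\<lambda>i. lv (Suc (Suc (Suc n))) (case_nat x (case_nat b (case_nat a' e'))) ((id(n := Suc (Suc n))) i)) q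
          = satE (mix (\<lambda>_. x) c) p"
          unfolding q_def sat_rename
        proof (rule sat_cong)
          fix i assume "i \<in> fv p"
          then have "i < n" by (rule n)
          moreover have "lv n e' j = c j" if "j < n" for j using that by (simp add: lv_def e'_def)
          ultimately show "((\<lambda>i. lv (Suc (Suc (Suc n))) (case_nat x (case_nat b (case_nat a' e'))) ((id(n := Suc (Suc n))) i)) \<circ> r) i =
            mix (\<lambda>_. x) c i"
            by (auto simp: r_def mix_def)
        qed
        then show ?thesis using p[of "\<lambda>_. x"] by simp
      qed
      ultimately show ?thesis by (simp add: sat_inst_l del: fun_upd_apply)
    qed
  qed
qed

lemma ZF_closed: "p \<in> ZF \<Longrightarrow> fv p = {}"
proof -
  have pow: "fv ((All ^^ n) q) = {m. m + n \<in> fv q}" for n q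
    by (induction n) auto
  have sep: "fv (separation_axiom n p) = {}" if "fv p \<subseteq> {..n}" for n p
  proof -
    have "Suc (Suc (Suc n)) - Suc ((id(n := Suc (Suc n))) i) \<in> insert 0 {3..n + 2}" if "i \<in> fv p" for i
      using that \<open>fv p \<subseteq> {..n}\<close> by (cases "i = n") auto
    then have "fv (inst_l p (id(n := Suc (Suc n))) (Suc (Suc (Suc n)))) \<subseteq> insert 0 {3..n + 2}"
      unfolding inst_l_def fv_rename by (rule image_subsetI)
    then show ?thesis
      unfolding separation_axiom_def pow
      by (auto simp: all_l_def ex_l_def not_l_def iff_l_def and_l_def imp_l_def mem_l_def)
  qed
  have rep: "fv (replacement_axiom n p) = {}" if "fv p \<subseteq> {..Suc n}" for n p
  proof -
    have *: "d - Suc ((id(n := x, Suc n := y)) i) \<in> {d - Suc x, d - Suc y} \<union> {d - n..d - 1}"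
      if "i \<in> fv p" "n < d" for i x y d
      using that \<open>fv p \<subseteq> {..Suc n}\<close> by (cases "i = n"; cases "i = Suc n") auto
    have "fv (inst_l p (id(n := x, Suc n := y)) d) \<subseteq> {d - Suc x, d - Suc y} \<union> {d - n..d - 1}" if "n < d" for x y d
      unfolding inst_l_def fv_rename by (rule image_subsetI) (use * that in blast)
    note ** = this[of "Suc (Suc (Suc (Suc n)))" "Suc n" "Suc (Suc n)"] this[of "Suc (Suc (Suc (Suc n)))" "Suc n" "Suc (Suc (Suc n))"]
      this[of "Suc (Suc (Suc (Suc n)))" "Suc (Suc (Suc n))" "Suc (Suc n)"]
    show ?thesis
      unfolding replacement_axiom_def pow Let_def
      using **
      by (auto simp: all_l_def ex_l_def not_l_def iff_l_def and_l_def imp_l_def mem_l_def eq_l_def)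
  qed
  show ?thesis if "p \<in> ZF"
    using that sep rep unfolding ZF_def
    by (auto simp: extensionality_axiom_def foundation_axiom_def pairing_axiom_def union_axiom_def
        powerset_axiom_def infinity_axiom_def is_subset_def is_upair_def is_inductive_def is_empty_def is_succ_def
        all_l_def ex_l_def not_l_def iff_l_def and_l_def or_l_def imp_l_def mem_l_def eq_l_def)
qed

text \<open>
If there were only finitely many elements up to \<open>Q\<close>, pairing and union would collect all of them in one set,
against foundation. So the quotient of the term model is infinite and can again be built on the
natural numbers.
\<close>

lemma infinitely_many_classes:
  fixes Q :: "nat \<Rightarrow> nat \<Rightarrow> bool" and M e
  assumes eq: "equivp Q" and cong: "\<And>x y x' y'. Q x y \<Longrightarrow> Q x' y' \<Longrightarrow> M x x' \<longleftrightarrow> M y y'"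
    and sat: "\<And>p. p \<in> ZF \<Longrightarrow> sat M Q e p"
    and rep: "\<And>x. Q x (rep x)"
  shows "infinite (range rep)"
proof
  note axs = sat[OF subsetD[OF ZF_schemas(1)]]
  have pair: "\<exists>z. \<forall>w. M w z \<longleftrightarrow> Q w x \<or> Q w y" for x y
    using axs[of pairing_axiom] unfolding pairing_axiom_def is_upair_def by simp
  have un: "\<exists>u. \<forall>z. M z u \<longleftrightarrow> (\<exists>y. M z y \<and> M y x)" for x
    using axs[of union_axiom] unfolding union_axiom_def by simp
  have found: "\<exists>y. M y x \<and> \<not> (\<exists>z. M z x \<and> M z y)" if "M y x" for x y
    using axs[of foundation_axiom] that unfolding foundation_axiom_def by simp blast
  have refl: "Q x x" for x using eq by (simp add: equivp_reflp)
  have sym: "Q x y \<Longrightarrow> Q y x" for x y using eq by (meson equivp_symp)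
  assume fin: "finite (range rep)"
  have *: "\<exists>u. \<forall>z. M z u \<longleftrightarrow> (\<exists>y\<in>F. Q z y)" if "finite F" "F \<noteq> {}" for F
    using that
  proof (induction F rule: finite_ne_induct)
    case (singleton x)
    then show ?case using pair[of x x] by simp
  next
    case (insert x F)
    then obtain u where u: "M z u \<longleftrightarrow> (\<exists>y\<in>F. Q z y)" for z by blast
    obtain v where v: "M z v \<longleftrightarrow> Q z x" for z using pair[of x x] by blast
    obtain w where w: "M z w \<longleftrightarrow> Q z u \<or> Q z v" for z using pair[of u v] by blast
    obtain t where "M z t \<longleftrightarrow> (\<exists>y. M z y \<and> M y w)" for z using un[of w] by blast
    moreover have "M z y \<longleftrightarrow> M z y'" if "Q y y'" for z y y' using cong[OF refl that] .
    ultimately have "M z t \<longleftrightarrow> M z u \<or> M z v" for z using w refl by blast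
    then show ?case using u v by auto
  qed
  obtain u where "\<forall>z. M z u \<longleftrightarrow> (\<exists>y\<in>range rep. Q z y)" using *[OF fin] by auto
  then have u: "M z u" for z using rep[of z] by auto
  obtain s where s: "M z s \<longleftrightarrow> Q z u" for z using pair[of u u] by blast
  then obtain y where "M y s" "\<not> (\<exists>z. M z s \<and> M z y)" using found[of u s] refl by blast
  then show False using s u cong[OF refl sym, of y u u] refl by blast
qed

lemma ZF_derivable:
  assumes valid: "\<And>E :: nat \<Rightarrow> nat \<Rightarrow> bool. \<And>e. zf E \<Longrightarrow> sat E (=) e p"
  shows "ZF \<turnstile> p"
proof (rule completeness)
  show "finite (\<Union> (fv ` ZF))" using ZF_closed by simp
  fix M Q :: "nat \<Rightarrow> nat \<Rightarrow> bool" and e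
  assume eq: "equivp Q" and cong: "\<And>x y x' y'. Q x y \<Longrightarrow> Q x' y' \<Longrightarrow> M x x' \<longleftrightarrow> M y y'"
    and sat: "\<And>p. p \<in> ZF \<Longrightarrow> sat M Q e p"
  define rep where "rep x = (LEAST y. Q x y)" for x
  have rep: "Q x (rep x)" for x unfolding rep_def by (rule LeastI[of _ x]) (use eq equivp_reflp in metis)
  have rep_eq: "rep x = rep y" if "Q x y" for x y
  proof -
    have "Q x = Q y" using eq that by (simp add: equivp_def)
    then show ?thesis unfolding rep_def by simp
  qed
  have Q: "Q x y \<longleftrightarrow> rep x = rep y" for x y
    using rep[of x] rep[of y] rep_eq[of x y] eq by (metis equivp_symp equivp_transp)
  let ?s = "enumerate (range rep)"
  have bij: "bij_betw ?s UNIV (range rep)"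
    by (rule bij_enumerate) (rule infinitely_many_classes[OF eq cong sat rep])
  define g where "g x = inv_into UNIV ?s (rep x)" for x
  have sg: "?s (g x) = rep x" for x unfolding g_def
    by (rule bij_betw_inv_into_right[OF bij]) simp
  have "surj g"
  proof (rule surjI)
    fix n
    obtain y where "rep y = ?s n" using bij by (metis UNIV_I bij_betwE imageE)
    moreover have "rep (rep y) = rep y" using rep rep_eq by metis
    ultimately have "?s (g (?s n)) = ?s n" using sg[of "?s n"] by simp
    then show "g (?s n) = n" using bij by (metis UNIV_I bij_betw_def inj_onD)
  qed
  have QG: "Q x y \<longleftrightarrow> g x = g y" for x y
    unfolding Q using sg by (metis g_def)
  define E where "E u v = M (?s u) (?s v)" for u v
  have ME: "M x y \<longleftrightarrow> E (g x) (g y)" for x y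
    unfolding E_def sg using cong rep by metis
  note transfer = sat_surj[where M' = E and Q' = "(=)", OF \<open>surj g\<close> ME QG]
  have "zf E" by (rule zf_of_sat[of _ "g \<circ> e"]) (use sat transfer in blast)
  then show "sat M Q e p" unfolding transfer by (rule valid)
qed

context zf
begin

section \<open>Elementary set theory in a model\<close>

lemma THE_set:
  assumes "\<exists>b. \<forall>x. x \<epsilon> b \<longleftrightarrow> Q x" shows "x \<epsilon> (THE b. \<forall>x. x \<epsilon> b \<longleftrightarrow> Q x) \<longleftrightarrow> Q x"
proof -
  have "\<exists>!b. \<forall>x. x \<epsilon> b \<longleftrightarrow> Q x" using assms by (metis ext)
  from theI'[OF this] show ?thesis by simp
qed

text \<open>
The set-theoretic operations are functions on the model, so that separation can be applied to
predicates with compound terms.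
\<close>

definition up :: "'a \<Rightarrow> 'a \<Rightarrow> 'a" where
  "up a b = (THE p. \<forall>z. z \<epsilon> p \<longleftrightarrow> z = a \<or> z = b)"

definition pow :: "'a \<Rightarrow> 'a" where
  "pow a = (THE p. \<forall>z. z \<epsilon> p \<longleftrightarrow> sub z a)"

definition sep :: "'a \<Rightarrow> ('a \<Rightarrow> bool) \<Rightarrow> 'a" where
  "sep a P = (THE b. \<forall>x. x \<epsilon> b \<longleftrightarrow> x \<epsilon> a \<and> P x)"

definition zer :: 'a where
  "zer = (THE b. \<forall>x. x \<epsilon> b \<longleftrightarrow> False)"

definition un :: "'a \<Rightarrow> 'a \<Rightarrow> 'a" where
  "un a b = (THE u. \<forall>z. z \<epsilon> u \<longleftrightarrow> z \<epsilon> a \<or> z \<epsilon> b)"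

definition pr :: "'a \<Rightarrow> 'a \<Rightarrow> 'a" where
  "pr a b = up (up a a) (up a b)"

definition sc :: "'a \<Rightarrow> 'a" where
  "sc a = un a (up a a)"

lemma mem_up [simp]: "z \<epsilon> up a b \<longleftrightarrow> z = a \<or> z = b"
  unfolding up_def by (rule THE_set) (use pairing in \<open>simp add: upair_def\<close>)

lemma mem_pow [simp]: "z \<epsilon> pow a \<longleftrightarrow> sub z a"
  unfolding pow_def by (rule THE_set[OF powerset])

lemma mem_sep: "definable (\<lambda>e. P (e 0)) \<Longrightarrow> z \<epsilon> sep a P \<longleftrightarrow> z \<epsilon> a \<and> P z"
  unfolding sep_def by (rule THE_set[OF separation])

lemma mem_zer [simp]: "\<not> z \<epsilon> zer"
proof -
  have "\<exists>b. \<forall>x. x \<epsilon> b \<longleftrightarrow> False" using separation[OF definable_const[of False]] by simp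
  from THE_set[OF this] show ?thesis unfolding zer_def by simp
qed

lemma mem_un [simp]: "z \<epsilon> un a b \<longleftrightarrow> z \<epsilon> a \<or> z \<epsilon> b"
proof -
  obtain u where "\<forall>z. z \<epsilon> u \<longleftrightarrow> (\<exists>y. z \<epsilon> y \<and> y \<epsilon> up a b)" using union by blast
  then have "\<exists>u. \<forall>z. z \<epsilon> u \<longleftrightarrow> z \<epsilon> a \<or> z \<epsilon> b" by auto
  from THE_set[OF this] show ?thesis unfolding un_def by simp
qed

lemma mem_sc [simp]: "z \<epsilon> sc a \<longleftrightarrow> z \<epsilon> a \<or> z = a"
  unfolding sc_def by simp

lemma ext_iff: "x = y \<longleftrightarrow> (\<forall>z. z \<epsilon> x \<longleftrightarrow> z \<epsilon> y)"
  using ext by blast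

lemma emp_iff [simp]: "emp x \<longleftrightarrow> x = zer"
  unfolding emp_def ext_iff[of x zer] by simp

lemma succ_iff [simp]: "succ x y \<longleftrightarrow> y = sc x"
  unfolding succ_def ext_iff[of y "sc x"] by simp

lemma upair_iff [simp]: "upair a b p \<longleftrightarrow> p = up a b"
  unfolding upair_def ext_iff[of p "up a b"] by simp

lemma opair_iff [simp]: "opair a b p \<longleftrightarrow> p = pr a b"
  unfolding opair_def pr_def by simp

lemma maps_iff [simp]: "maps f x y \<longleftrightarrow> pr x y \<epsilon> f"
  unfolding maps_def by simp

lemma pr_inject [simp]: "pr a b = pr c d \<longleftrightarrow> a = c \<and> b = d"
proof
  have up: "up x y = up z w \<longleftrightarrow> (x = z \<and> y = w) \<or> (x = w \<and> y = z)" for x y z w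
    unfolding ext_iff[of "up x y"] by auto
  assume "pr a b = pr c d"
  then show "a = c \<and> b = d" unfolding pr_def up by auto
qed simp

lemma definable_term_up [definability]: "definable_term t \<Longrightarrow> definable_term u \<Longrightarrow> definable_term (\<lambda>e. up (t e) (u e))"
  by (rule definable_term_relation2[where R = upair]) (simp, (intro definability | assumption)+)

lemma definable_term_pr [definability]: "definable_term t \<Longrightarrow> definable_term u \<Longrightarrow> definable_term (\<lambda>e. pr (t e) (u e))"
  unfolding pr_def by (intro definability)

lemma definable_term_sc [definability]: "definable_term t \<Longrightarrow> definable_term (\<lambda>e. sc (t e))"
  by (rule definable_term_relation1[where R = succ]) (simp, (intro definability | assumption)+)

lemma sub_antisym: "sub x y \<Longrightarrow> sub y x \<Longrightarrow> x = y"
  unfolding sub_def by (blast intro: ext)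

lemma not_mem_cycle: "x \<epsilon> y \<Longrightarrow> \<not> y \<epsilon> x"
  using foundation[of x "up x y"] by auto

lemma not_mem_self [simp]: "\<not> x \<epsilon> x"
  using not_mem_cycle by blast

lemma sc_inject [simp]: "sc x = sc y \<longleftrightarrow> x = y"
proof
  assume "sc x = sc y"
  then have "x \<epsilon> sc y" "y \<epsilon> sc x" by (metis mem_sc)+
  then show "x = y" using not_mem_cycle by auto
qed simp

lemma sc_neq_zer [simp]: "sc x \<noteq> zer" "zer \<noteq> sc x"
  using mem_zer[of x] mem_sc[of x x] by metis+

text \<open>
As the intersection of all inductive sets, \<open>\<omega>\<close> needs no choice of an inductive set.
\<close>

definition om :: 'a where
  "om = (THE w. \<forall>x. x \<epsilon> w \<longleftrightarrow> (\<forall>v. indset v \<longrightarrow> x \<epsilon> v))"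

lemma mem_om: "x \<epsilon> om \<longleftrightarrow> (\<forall>v. indset v \<longrightarrow> x \<epsilon> v)"
proof -
  obtain w where w: "indset w" using infinity by blast
  have "definable (\<lambda>e. \<forall>v. indset v \<longrightarrow> e 0 \<epsilon> v)" by (intro definability)
  then obtain u where "\<forall>x. x \<epsilon> u \<longleftrightarrow> x \<epsilon> w \<and> (\<forall>v. indset v \<longrightarrow> x \<epsilon> v)"
    using separation[of "\<lambda>x. \<forall>v. indset v \<longrightarrow> x \<epsilon> v" w] by blast
  then have "\<exists>u. \<forall>x. x \<epsilon> u \<longleftrightarrow> (\<forall>v. indset v \<longrightarrow> x \<epsilon> v)" using w by blast
  from THE_set[OF this] show ?thesis unfolding om_def .
qed

lemma indset_iff: "indset w \<longleftrightarrow> zer \<epsilon> w \<and> (\<forall>x. x \<epsilon> w \<longrightarrow> sc x \<epsilon> w)"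
  unfolding indset_def by simp

lemma zer_om [simp]: "zer \<epsilon> om" and sc_om [simp]: "n \<epsilon> om \<Longrightarrow> sc n \<epsilon> om"
  unfolding mem_om indset_iff by auto

lemma omega_iff [simp]: "omega w \<longleftrightarrow> w = om"
proof
  have "indset om" by (simp add: indset_iff)
  moreover have "sub om v" if "indset v" for v using that by (auto simp: sub_def mem_om)
  ultimately show "w = om \<Longrightarrow> omega w" "omega w \<Longrightarrow> w = om"
    unfolding omega_def by (auto intro: sub_antisym)
qed

text \<open>
Induction holds only for definable predicates, since the model may have nonstandard numbers.
\<close>

lemma om_induct:
  assumes "n \<epsilon> om" "definable (\<lambda>e. P (e 0))" "P zer" "\<And>n. n \<epsilon> om \<Longrightarrow> P n \<Longrightarrow> P (sc n)"
  shows "P n"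
proof -
  have "indset (sep om P)" using assms(3,4) by (auto simp: indset_iff mem_sep[OF assms(2)])
  then show ?thesis using assms(1) mem_om mem_sep[OF assms(2)] by blast
qed

lemma om_mem: assumes "n \<epsilon> om" "m \<epsilon> n" shows "m \<epsilon> om"
proof -
  have "\<forall>m. m \<epsilon> n \<longrightarrow> m \<epsilon> om"
    using assms(1) by (rule om_induct, (intro definability)[1]) auto
  then show ?thesis using assms(2) by blast
qed

lemma om_trans: assumes "n \<epsilon> om" "m \<epsilon> n" "k \<epsilon> m" shows "k \<epsilon> n"
proof -
  have "\<forall>m k. m \<epsilon> n \<longrightarrow> k \<epsilon> m \<longrightarrow> k \<epsilon> n"
    using assms(1) by (rule om_induct, (intro definability)[1]) auto
  then show ?thesis using assms(2,3) by blast
qed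

lemma sc_mem_sc: assumes "n \<epsilon> om" "m \<epsilon> n" shows "sc m \<epsilon> sc n"
proof -
  have "\<forall>m. m \<epsilon> n \<longrightarrow> sc m \<epsilon> sc n"
    using assms(1) by (rule om_induct, (intro definability)[1]) auto
  then show ?thesis using assms(2) by blast
qed

lemma zer_mem: "n \<epsilon> om \<Longrightarrow> n = zer \<or> zer \<epsilon> n"
  by (rule om_induct[of n], assumption, (intro definability)[1]) auto

lemma om_linear:
  assumes "m \<epsilon> om" "n \<epsilon> om" shows "m \<epsilon> n \<or> m = n \<or> n \<epsilon> m"
proof -
  have "\<forall>n. n \<epsilon> om \<longrightarrow> m \<epsilon> n \<or> m = n \<or> n \<epsilon> m"
    using assms(1)
  proof (rule om_induct, (intro definability)[1])
    show "\<forall>n. n \<epsilon> om \<longrightarrow> zer \<epsilon> n \<or> zer = n \<or> n \<epsilon> zer" using zer_mem by blast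
    fix m assume IH: "\<forall>n. n \<epsilon> om \<longrightarrow> m \<epsilon> n \<or> m = n \<or> n \<epsilon> m"
    show "\<forall>n. n \<epsilon> om \<longrightarrow> sc m \<epsilon> n \<or> sc m = n \<or> n \<epsilon> sc m"
      using IH sc_mem_sc mem_sc by blast
  qed
  then show ?thesis using assms(2) by blast
qed

lemma om_least:
  assumes "n \<epsilon> om" "definable (\<lambda>e. P (e 0))" "P n"
  obtains m where "m \<epsilon> om" "P m" "\<And>k. k \<epsilon> m \<Longrightarrow> \<not> P k"
proof -
  note sep = mem_sep[OF assms(2)]
  obtain m where "m \<epsilon> sep om P" "\<not> (\<exists>z. z \<epsilon> sep om P \<and> z \<epsilon> m)"
    using foundation[of n "sep om P"] assms sep by blast
  then show ?thesis using that[of m] om_mem sep by blast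
qed

definition one :: 'a where
  "one = sc zer"

definition tw :: 'a where
  "tw = sc one"

lemma mem_one [simp]: "i \<epsilon> one \<longleftrightarrow> i = zer"
  by (simp add: one_def)

lemma mem_tw [simp]: "i \<epsilon> tw \<longleftrightarrow> i = zer \<or> i = one"
  by (simp add: tw_def)

lemma one_neq_zer [simp]: "one \<noteq> zer" "zer \<noteq> one"
  by (simp_all add: one_def)

lemma one_om [simp]: "one \<epsilon> om"
  by (simp add: one_def)

lemma two_iff [simp]: "two t \<longleftrightarrow> t = tw"
  by (simp add: two_def one_def tw_def)

section \<open>Functions and operations\<close>

definition cart :: "'a \<Rightarrow> 'a \<Rightarrow> 'a" where
  "cart a b = sep (pow (pow (un a b))) (\<lambda>p. \<exists>x y. x \<epsilon> a \<and> y \<epsilon> b \<and> p = pr x y)"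

lemma mem_cart: "p \<epsilon> cart a b \<longleftrightarrow> (\<exists>x y. x \<epsilon> a \<and> y \<epsilon> b \<and> p = pr x y)"
proof -
  have "definable (\<lambda>e. \<exists>x y. x \<epsilon> a \<and> y \<epsilon> b \<and> e 0 = pr x y)" by (intro definability)
  from mem_sep[OF this] show ?thesis unfolding cart_def by (auto simp: sub_def pr_def)
qed

lemma pr_mem_cart [simp]: "pr x y \<epsilon> cart a b \<longleftrightarrow> x \<epsilon> a \<and> y \<epsilon> b"
  by (auto simp: mem_cart)

text \<open>
The form of separation by which all relations and functions below are introduced.
\<close>

lemma sep_pairs:
  assumes "definable (\<lambda>e. Q (e 0) (e 1))"
  shows "\<exists>q. sub q (cart A B) \<and> (\<forall>y z. pr y z \<epsilon> q \<longleftrightarrow> y \<epsilon> A \<and> z \<epsilon> B \<and> Q y z)"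
proof -
  have "definable (\<lambda>e. \<exists>y z. e 0 = pr y z \<and> Q y z)" by (intro definability definable_subst2[where P = Q, OF assms])
  from mem_sep[OF this, of _ "cart A B"] show ?thesis
    by (intro exI[of _ "sep (cart A B) (\<lambda>p. \<exists>y z. p = pr y z \<and> Q y z)"]) (auto simp: sub_def)
qed

lemma sub_cart: "sub f (cart a b) \<Longrightarrow> pr x y \<epsilon> f \<Longrightarrow> x \<epsilon> a \<and> y \<epsilon> b"
  unfolding sub_def using pr_mem_cart by blast

lemma func_iff: "func f A B \<longleftrightarrow> sub f (cart A B) \<and> (\<forall>x. x \<epsilon> A \<longrightarrow> (\<exists>y. pr x y \<epsilon> f)) \<and>
    (\<forall>x y z. pr x y \<epsilon> f \<longrightarrow> pr x z \<epsilon> f \<longrightarrow> y = z)"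
proof -
  have "func f A B \<longleftrightarrow> sub f (cart A B) \<and>
    (\<forall>x. x \<epsilon> A \<longrightarrow> (\<exists>y. pr x y \<epsilon> f \<and> (\<forall>z. pr x z \<epsilon> f \<longrightarrow> z = y)))"
    unfolding func_def sub_def mem_cart by auto
  then show ?thesis using sub_cart[of f A B] by metis
qed

lemma funcI:
  assumes "sub f (cart A B)" "\<And>x. x \<epsilon> A \<Longrightarrow> \<exists>y. pr x y \<epsilon> f" "\<And>x y z. pr x y \<epsilon> f \<Longrightarrow> pr x z \<epsilon> f \<Longrightarrow> y = z"
  shows "func f A B"
  unfolding func_iff using assms by blast

lemma func_mem: "func f A B \<Longrightarrow> pr x y \<epsilon> f \<Longrightarrow> x \<epsilon> A \<and> y \<epsilon> B"
  unfolding func_iff using sub_cart by blast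

lemma func_val: "func f A B \<Longrightarrow> x \<epsilon> A \<Longrightarrow> \<exists>y. pr x y \<epsilon> f"
  unfolding func_iff by blast

lemma func_eq: "func f A B \<Longrightarrow> pr x y \<epsilon> f \<Longrightarrow> pr x z \<epsilon> f \<Longrightarrow> y = z"
  unfolding func_iff by blast

lemma func_ext:
  assumes f: "func f A B" and g: "func g A B'" and eq: "\<And>x y. pr x y \<epsilon> f \<Longrightarrow> pr x y \<epsilon> g"
  shows "f = g"
proof (rule sub_antisym)
  show "sub f g" using f eq unfolding func_iff sub_def mem_cart by blast
  show "sub g f" unfolding sub_def
  proof (intro allI impI)
    fix p assume p: "p \<epsilon> g"
    then obtain x y where xy: "p = pr x y" "x \<epsilon> A" using g unfolding func_iff sub_def mem_cart by blast
    then obtain z where "pr x z \<epsilon> f" using func_val[OF f] by blast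
    then show "p \<epsilon> f" using func_eq[OF g, of x y z] eq p xy by blast
  qed
qed

lemma func_differ:
  assumes f: "func f A B" and g: "func g A B'" and neq: "f \<noteq> g"
  obtains x y z where "pr x y \<epsilon> f" "pr x z \<epsilon> g" "y \<noteq> z"
proof -
  obtain x y where xy: "pr x y \<epsilon> f" "\<not> pr x y \<epsilon> g" using func_ext[OF f g] neq by blast
  then obtain z where "pr x z \<epsilon> g" using func_val[OF g] func_mem[OF f] by blast
  then show ?thesis using that xy by blast
qed

definition fs :: "'a \<Rightarrow> 'a \<Rightarrow> 'a" where
  "fs A B = sep (pow (cart A B)) (\<lambda>f. func f A B)"

lemma mem_fs [simp]: "f \<epsilon> fs A B \<longleftrightarrow> func f A B"
proof -
  have "definable (\<lambda>e. func (e 0) A B)" by (intro definability)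
  from mem_sep[OF this] show ?thesis unfolding fs_def by (auto simp: func_iff)
qed

lemma funspace_iff [simp]: "funspace A B S \<longleftrightarrow> S = fs A B"
  unfolding funspace_def ext_iff[of S] by simp

lemma arity_iff: "arity n \<longleftrightarrow> n \<epsilon> om \<and> n \<noteq> zer"
  unfolding arity_def by simp

lemma op_of_arity_iff [simp]: "op_of_arity X n f \<longleftrightarrow> func f (fs n X) X"
  unfolding op_of_arity_def by simp

lemma operation_iff: "operation X f \<longleftrightarrow> (\<exists>n. arity n \<and> func f (fs n X) X)"
  unfolding operation_def by simp

text \<open>
Arguments of operations are subsets of \<open>\<omega> \<times> X\<close>, as \<open>n \<subseteq> \<omega>\<close> for every arity \<open>n\<close>; this bounds the set of all
operations.
\<close>

definition ops :: "'a \<Rightarrow> 'a" where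
  "ops X = sep (pow (cart (pow (cart om X)) X)) (operation X)"

lemma mem_ops [simp]: "f \<epsilon> ops X \<longleftrightarrow> operation X f"
proof -
  have "definable (\<lambda>e. operation X (e 0))" by (intro definability)
  from mem_sep[OF this] have "f \<epsilon> ops X \<longleftrightarrow> sub f (cart (pow (cart om X)) X) \<and> operation X f"
    unfolding ops_def by simp
  moreover have "sub f (cart (pow (cart om X)) X)" if op: "operation X f"
  proof -
    obtain n where n: "n \<epsilon> om" "func f (fs n X) X" using op unfolding operation_iff arity_iff by blast
    have "sub a (cart om X)" if "func a n X" for a
      using that om_mem[OF n(1)] unfolding func_iff sub_def mem_cart by blast
    then show ?thesis using n(2) unfolding func_iff[of f] sub_def[of f] mem_cart by auto
  qed
  ultimately show ?thesis by blast
qed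

lemma all_operations_iff [simp]: "all_operations X A \<longleftrightarrow> A = ops X"
  unfolding all_operations_def ext_iff[of A] by simp

text \<open>
The form of choice that is provable for a countable set: take the least witness with respect to the
enumeration \<open>N\<close>.
\<close>

lemma section_exists:
  assumes N: "bijection N om X" and Q: "definable (\<lambda>e. Q (e 0) (e 1))"
    and ex: "\<And>z. z \<epsilon> X \<Longrightarrow> \<exists>w. w \<epsilon> X \<and> Q z w"
  obtains t where "func t X X" "\<And>z w. pr z w \<epsilon> t \<Longrightarrow> Q z w"
proof -
  have f: "func N om X" and inj: "\<And>x y z. pr x z \<epsilon> N \<Longrightarrow> pr y z \<epsilon> N \<Longrightarrow> x = y"
    and surj: "\<And>y. y \<epsilon> X \<Longrightarrow> \<exists>x. pr x y \<epsilon> N"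
    using N unfolding bijection_def injection_def by auto
  define L where "L z w m \<longleftrightarrow> pr m w \<epsilon> N \<and> Q z w \<and> (\<forall>k v. k \<epsilon> m \<longrightarrow> pr k v \<epsilon> N \<longrightarrow> \<not> Q z v)" for z w m
  define t where "t = sep (cart X X) (\<lambda>p. \<exists>z w m. p = pr z w \<and> L z w m)"
  note DQ = definable_subst2[where P = Q, OF Q]
  have "definable (\<lambda>e. \<exists>z w m. e 0 = pr z w \<and> L z w m)"
    unfolding L_def by (intro definability DQ)
  from mem_sep[OF this] have t: "pr z w \<epsilon> t \<longleftrightarrow> z \<epsilon> X \<and> w \<epsilon> X \<and> (\<exists>m. L z w m)"
    and sub: "sub t (cart X X)" for z w
    unfolding t_def by (auto simp: sub_def)
  have "func t X X"
  proof (rule funcI[OF sub])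
    fix z assume z: "z \<epsilon> X"
    then obtain w n where w: "w \<epsilon> X" "Q z w" "pr n w \<epsilon> N" using ex surj by blast
    then have "n \<epsilon> om" using func_mem[OF f] by blast
    moreover have "definable (\<lambda>e. \<exists>w. pr (e 0) w \<epsilon> N \<and> Q z w)" by (intro definability DQ)
    ultimately obtain m where m: "m \<epsilon> om" "\<exists>w. pr m w \<epsilon> N \<and> Q z w" "\<And>k. k \<epsilon> m \<Longrightarrow> \<not> (\<exists>w. pr k w \<epsilon> N \<and> Q z w)"
      using om_least[of n "\<lambda>m. \<exists>w. pr m w \<epsilon> N \<and> Q z w"] w by blast
    then obtain v where "L z v m" unfolding L_def by blast
    then show "\<exists>y. pr z y \<epsilon> t" unfolding t L_def using func_mem[OF f] z by blast
  next
    fix z w w' assume "pr z w \<epsilon> t" "pr z w' \<epsilon> t"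
    then obtain m m' where m: "L z w m" "L z w' m'" unfolding t by blast
    then have "\<not> m \<epsilon> m'" "\<not> m' \<epsilon> m" unfolding L_def by blast+
    then have "m = m'" using om_linear func_mem[OF f] m unfolding L_def by blast
    then show "w = w'" using m func_eq[OF f] unfolding L_def by blast
  qed
  moreover have "Q z w" if "pr z w \<epsilon> t" for z w using that unfolding t L_def by blast
  ultimately show ?thesis by (rule that)
qed

section \<open>Recursion on the natural numbers\<close>

text \<open>
The recursion with initial value \<open>a\<close> and the step from \<open>k\<close> at stage \<open>n\<close> to some \<open>k'\<close> with \<open>H x n k k'\<close>, defined
as the least relation closed under the steps. It is a relation between elements of the model and not
an element of it. The parameter \<open>x\<close> is explicit so that \<open>Rec H\<close> is definable in \<open>x\<close>, too.
\<close>

definition Rec :: "('a \<Rightarrow> 'a \<Rightarrow> 'a \<Rightarrow> 'a \<Rightarrow> bool) \<Rightarrow> 'a \<Rightarrow> 'a \<Rightarrow> 'a \<Rightarrow> 'a \<Rightarrow> bool" where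
  "Rec H x a n k \<longleftrightarrow> n \<epsilon> om \<and> k \<epsilon> om \<and>
     (\<forall>Y. pr zer a \<epsilon> Y \<and> (\<forall>n k k'. n \<epsilon> om \<and> k \<epsilon> om \<and> pr n k \<epsilon> Y \<and> H x n k k' \<longrightarrow> pr (sc n) k' \<epsilon> Y)
       \<longrightarrow> pr n k \<epsilon> Y)"

lemma definable_Rec:
  assumes H: "definable (\<lambda>e. H (e 0) (e 1) (e 2) (e 3))" and "definable_term x" "definable_term a" "definable_term n" "definable_term k"
  shows "definable (\<lambda>e. Rec H (x e) (a e) (n e) (k e))"
  using assms(2-)
  by (rule definable_subst4[where P = "Rec H", rotated], unfold Rec_def)
     (intro definability definable_subst4[where P = H, OF H] | assumption)+

lemma Rec_om: "Rec H x a n k \<Longrightarrow> n \<epsilon> om \<and> k \<epsilon> om"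
  unfolding Rec_def by blast

lemma Rec_zer: "a \<epsilon> om \<Longrightarrow> Rec H x a zer a"
  unfolding Rec_def by auto

lemma Rec_sc: "Rec H x a n k \<Longrightarrow> H x n k k' \<Longrightarrow> k' \<epsilon> om \<Longrightarrow> Rec H x a (sc n) k'"
  unfolding Rec_def by auto

text \<open>
The pairs that have a reason to be in the least closed set already form a closed set.
\<close>

lemma Rec_inv:
  assumes H: "definable (\<lambda>e. H (e 0) (e 1) (e 2) (e 3))"
    and cl: "\<And>n k k'. H x n k k' \<Longrightarrow> k' \<epsilon> om" and a: "a \<epsilon> om"
    and r: "Rec H x a n k"
  shows "(n = zer \<and> k = a) \<or> (\<exists>m k'. n = sc m \<and> Rec H x a m k' \<and> H x m k' k)"
proof -
  define P where "P n k \<longleftrightarrow> (n = zer \<and> k = a) \<or> (\<exists>m k'. n = sc m \<and> Rec H x a m k' \<and> H x m k' k)" for n k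
  define Y where "Y = sep (cart om om) (\<lambda>p. \<exists>n k. p = pr n k \<and> P n k)"
  have "definable (\<lambda>e. \<exists>n k. e 0 = pr n k \<and> P n k)"
    unfolding P_def by (intro definability definable_subst4[where P = H, OF H] definable_Rec[OF H])
  from mem_sep[OF this] have Y: "pr n k \<epsilon> Y \<longleftrightarrow> n \<epsilon> om \<and> k \<epsilon> om \<and> P n k" for n k unfolding Y_def by auto
  have P: "Rec H x a n k" if "P n k" for n k
    using that unfolding P_def
  proof (elim disjE exE conjE)
    show ?thesis if "n = zer" "k = a" using that Rec_zer[OF a] by simp
    show ?thesis if "n = sc m" "Rec H x a m k'" "H x m k' k" for m k'
      using that Rec_sc[of H x a m k' k] cl by metis
  qed
  have "pr zer a \<epsilon> Y" using a by (simp add: Y P_def)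
  moreover have "pr (sc n) k' \<epsilon> Y" if "n \<epsilon> om" "k \<epsilon> om" "pr n k \<epsilon> Y" "H x n k k'" for n k k'
  proof -
    have "P n k" using that(3) unfolding Y by (elim conjE)
    then have "P (sc n) k'" using P[of n k] that(4) unfolding P_def[of "sc n"] by blast
    then show ?thesis unfolding Y using that(1) cl[OF that(4)] by simp
  qed
  moreover have "pr zer a \<epsilon> Y \<and> (\<forall>n k k'. n \<epsilon> om \<and> k \<epsilon> om \<and> pr n k \<epsilon> Y \<and> H x n k k' \<longrightarrow> pr (sc n) k' \<epsilon> Y)
      \<longrightarrow> pr n k \<epsilon> Y"
    using r unfolding Rec_def by (elim conjE allE)
  ultimately have "pr n k \<epsilon> Y" by blast
  then show ?thesis unfolding Y P_def by blast
qed

lemma Rec_total: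
  assumes H: "definable (\<lambda>e. H (e 0) (e 1) (e 2) (e 3))"
    and cl: "\<And>n k k'. H x n k k' \<Longrightarrow> k' \<epsilon> om" and a: "a \<epsilon> om"
    and tot: "\<And>n k. n \<epsilon> om \<Longrightarrow> k \<epsilon> om \<Longrightarrow> \<exists>k'. H x n k k'"
    and n: "n \<epsilon> om"
  shows "\<exists>k. Rec H x a n k"
  using n
proof (rule om_induct)
  show "definable (\<lambda>e. \<exists>k. Rec H x a (e 0) k)" by (intro definability definable_Rec[OF H])
  show "\<exists>k. Rec H x a zer k" using Rec_zer[OF a] by blast
  show "\<exists>k. Rec H x a (sc n) k" if "\<exists>k. Rec H x a n k" for n
  proof -
    obtain k where k: "Rec H x a n k" using \<open>\<exists>k. Rec H x a n k\<close> by blast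
    then obtain k' where "H x n k k'" using tot Rec_om by metis
    then show ?thesis using Rec_sc[OF k] cl by metis
  qed
qed

lemma Rec_functional:
  assumes H: "definable (\<lambda>e. H (e 0) (e 1) (e 2) (e 3))"
    and cl: "\<And>n k k'. H x n k k' \<Longrightarrow> k' \<epsilon> om" and a: "a \<epsilon> om"
    and fn: "\<And>n k k' k''. H x n k k' \<Longrightarrow> H x n k k'' \<Longrightarrow> k' = k''"
    and r: "Rec H x a n k" "Rec H x a n k'"
  shows "k = k'"
proof -
  have inv: "(n = zer \<and> k = a) \<or> (\<exists>m k'. n = sc m \<and> Rec H x a m k' \<and> H x m k' k)"
    if "Rec H x a n k" for n k
    by (rule Rec_inv[OF H cl a that])
  have "\<forall>k k'. Rec H x a n k \<longrightarrow> Rec H x a n k' \<longrightarrow> k = k'"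
  proof (rule om_induct[of n])
    show "n \<epsilon> om" using Rec_om[OF r(1)] by blast
    show "definable (\<lambda>e. \<forall>k k'. Rec H x a (e 0) k \<longrightarrow> Rec H x a (e 0) k' \<longrightarrow> k = k')"
      by (intro definability definable_Rec[OF H])
    show "\<forall>k k'. Rec H x a zer k \<longrightarrow> Rec H x a zer k' \<longrightarrow> k = k'"
    proof (intro allI impI)
      fix k k' assume "Rec H x a zer k" "Rec H x a zer k'"
      from inv[OF this(1)] inv[OF this(2)] show "k = k'" by simp
    qed
    show "\<forall>k k'. Rec H x a (sc n) k \<longrightarrow> Rec H x a (sc n) k' \<longrightarrow> k = k'"
      if IH: "\<forall>k k'. Rec H x a n k \<longrightarrow> Rec H x a n k' \<longrightarrow> k = k'" for n
    proof (intro allI impI)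
      fix k k' assume "Rec H x a (sc n) k" "Rec H x a (sc n) k'"
      from inv[OF this(1)] inv[OF this(2)] obtain j j' where "Rec H x a n j" "H x n j k" "Rec H x a n j'" "H x n j' k'"
        by (metis sc_neq_zer(1) sc_inject)
      then show "k = k'" using IH fn by metis
    qed
  qed
  then show ?thesis using r by blast
qed

section \<open>Coding the nodes of two binary trees by natural numbers\<close>

definition dbl :: "'a \<Rightarrow> 'a \<Rightarrow> bool" where
  "dbl = Rec (\<lambda>_ _ k k'. k \<epsilon> om \<and> k' = sc (sc k)) zer zer"

lemma definable_dbl_step: "definable (\<lambda>e. e 2 \<epsilon> om \<and> e 3 = sc (sc (e 2)))"
  by (intro definability)

lemma definable_dbl [definability]: "definable_term k \<Longrightarrow> definable_term m \<Longrightarrow> definable (\<lambda>e. dbl (k e) (m e))"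
  unfolding dbl_def by (intro definable_Rec definability | assumption)+

lemma dbl_om: "dbl k m \<Longrightarrow> k \<epsilon> om \<and> m \<epsilon> om"
  unfolding dbl_def by (rule Rec_om)

lemma dbl_inv: "dbl k m \<Longrightarrow> (k = zer \<and> m = zer) \<or> (\<exists>j l. k = sc j \<and> dbl j l \<and> m = sc (sc l))"
  unfolding dbl_def by (drule Rec_inv[OF definable_dbl_step, rotated 2]) auto

lemma dbl_total: "k \<epsilon> om \<Longrightarrow> \<exists>m. dbl k m"
  unfolding dbl_def by (rule Rec_total[OF definable_dbl_step]) auto

lemma dbl_functional: "dbl k m \<Longrightarrow> dbl k m' \<Longrightarrow> m = m'"
  unfolding dbl_def by (erule Rec_functional[OF definable_dbl_step, rotated 3]) auto

lemma dbl_even: assumes "dbl k m" shows "\<not> dbl k' (sc m)"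
proof -
  have "\<forall>k' m. dbl k m \<longrightarrow> \<not> dbl k' (sc m)"
  proof (rule om_induct[of k])
    show "k \<epsilon> om" using dbl_om[OF assms] by blast
    show "definable (\<lambda>e. \<forall>k' m. dbl (e 0) m \<longrightarrow> \<not> dbl k' (sc m))" by (intro definability)
    show "\<forall>k' m. dbl zer m \<longrightarrow> \<not> dbl k' (sc m)" using dbl_inv[of zer] dbl_inv[of _ "sc zer"] by auto
    show "\<forall>k' m. dbl (sc n) m \<longrightarrow> \<not> dbl k' (sc m)" if "\<forall>k' m. dbl n m \<longrightarrow> \<not> dbl k' (sc m)" for n
    proof (intro allI impI notI)
      fix k' m assume "dbl (sc n) m" "dbl k' (sc m)"
      from dbl_inv[OF this(1)] dbl_inv[OF this(2)] that show False by auto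
    qed
  qed
  then show ?thesis using assms by blast
qed

lemma dbl_inject: assumes "dbl k m" "dbl k' m" shows "k = k'"
proof -
  have "\<forall>k' m. dbl k m \<longrightarrow> dbl k' m \<longrightarrow> k = k'"
  proof (rule om_induct[of k])
    show "k \<epsilon> om" using dbl_om[OF assms(1)] by blast
    show "definable (\<lambda>e. \<forall>k' m. dbl (e 0) m \<longrightarrow> dbl k' m \<longrightarrow> e 0 = k')" by (intro definability)
    show "\<forall>k' m. dbl zer m \<longrightarrow> dbl k' m \<longrightarrow> zer = k'" using dbl_inv[of zer] dbl_inv[of _ zer] by auto
    show "\<forall>k' m. dbl (sc n) m \<longrightarrow> dbl k' m \<longrightarrow> sc n = k'" if "\<forall>k' m. dbl n m \<longrightarrow> dbl k' m \<longrightarrow> n = k'" for n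
    proof (intro allI impI)
      fix k' m assume "dbl (sc n) m" "dbl k' m"
      from dbl_inv[OF this(1)] dbl_inv[OF this(2)] that show "sc n = k'" by auto
    qed
  qed
  then show ?thesis using assms by blast
qed

text \<open>
The children of the node \<open>k\<close> are \<open>2k + 2\<close> and \<open>2k + 3\<close>. So \<open>0\<close> and \<open>1\<close> are children of no node,
and serve as the roots of two disjoint trees.
\<close>

definition child :: "'a \<Rightarrow> 'a \<Rightarrow> 'a \<Rightarrow> bool" where
  "child k j l \<longleftrightarrow> (\<exists>m. dbl k m \<and> ((j = zer \<and> l = sc (sc m)) \<or> (j = one \<and> l = sc (sc (sc m)))))"

lemma definable_child [definability]: "definable_term k \<Longrightarrow> definable_term j \<Longrightarrow> definable_term l \<Longrightarrow> definable (\<lambda>e. child (k e) (j e) (l e))"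
  by (rule definable_subst3[where P = child], unfold child_def) (intro definability | assumption)+

lemma child_om: "child k j l \<Longrightarrow> l \<epsilon> om"
  unfolding child_def using dbl_om by auto

lemma child_total: "k \<epsilon> om \<Longrightarrow> j \<epsilon> tw \<Longrightarrow> \<exists>l. child k j l"
  unfolding child_def using dbl_total[of k] by auto

lemma child_functional: "child k j l \<Longrightarrow> child k j l' \<Longrightarrow> l = l'"
  unfolding child_def using dbl_functional by (metis one_neq_zer(1))

lemma child_inject:
  assumes "child k j l" "child k' j' l" shows "k = k' \<and> j = j'"
proof -
  obtain m m' where m: "dbl k m" "dbl k' m'"
    and l: "(j = zer \<and> l = sc (sc m)) \<or> (j = one \<and> l = sc (sc (sc m)))"
    "(j' = zer \<and> l = sc (sc m')) \<or> (j' = one \<and> l = sc (sc (sc m')))"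
    using assms unfolding child_def by blast
  moreover have "m \<noteq> sc m'" "m' \<noteq> sc m" using dbl_even m by blast+
  ultimately show ?thesis using dbl_inject by auto
qed

lemma child_not_root: "child k j l \<Longrightarrow> \<not> l \<epsilon> tw"
  unfolding child_def by (auto simp: one_def)

text \<open>
The \<open>n\<close>-th digit of \<open>x\<close> decides which child of the current node the branch of \<open>x\<close> goes through.
\<close>

definition node_step :: "'a \<Rightarrow> 'a \<Rightarrow> 'a \<Rightarrow> 'a \<Rightarrow> bool" where
  "node_step x n k l \<longleftrightarrow> (\<exists>j. pr n j \<epsilon> x \<and> child k j l)"

definition node :: "'a \<Rightarrow> 'a \<Rightarrow> 'a \<Rightarrow> 'a \<Rightarrow> bool" where
  "node = Rec node_step"

lemma definable_node_step: "definable (\<lambda>e. node_step (e 0) (e 1) (e 2) (e 3))"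
  unfolding node_step_def by (intro definability)

lemma definable_node [definability]: "definable_term x \<Longrightarrow> definable_term i \<Longrightarrow> definable_term n \<Longrightarrow> definable_term k \<Longrightarrow> definable (\<lambda>e. node (x e) (i e) (n e) (k e))"
  unfolding node_def by (rule definable_Rec[OF definable_node_step])

lemma tw_om: "i \<epsilon> tw \<Longrightarrow> i \<epsilon> om" by auto

lemma node_om: "node x i n k \<Longrightarrow> n \<epsilon> om \<and> k \<epsilon> om"
  unfolding node_def by (rule Rec_om)

lemma node_inv:
  assumes "i \<epsilon> tw" "node x i n k"
  shows "(n = zer \<and> k = i) \<or> (\<exists>m k'. n = sc m \<and> node x i m k' \<and> node_step x m k' k)"
  using assms(2) unfolding node_def
  by (rule Rec_inv[OF definable_node_step _ tw_om[OF assms(1)], rotated]) (use child_om node_step_def in blast)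

lemma node_total:
  assumes "func x om tw" "i \<epsilon> tw" "n \<epsilon> om" shows "\<exists>k. node x i n k"
  unfolding node_def
proof (rule Rec_total[OF definable_node_step _ tw_om[OF assms(2)] _ assms(3)])
  show "\<exists>k'. node_step x n k k'" if "n \<epsilon> om" "k \<epsilon> om" for n k
    unfolding node_step_def using func_val[OF assms(1) that(1)] func_mem[OF assms(1)] child_total[OF that(2)] by blast
qed (use child_om node_step_def in blast)

lemma node_functional:
  assumes "func x om tw" "i \<epsilon> tw" "node x i n k" "node x i n k'" shows "k = k'"
  using assms(3,4) unfolding node_def
proof (rule Rec_functional[OF definable_node_step _ tw_om[OF assms(2)], rotated 2])
  show "k' = k''" if "node_step x n k k'" "node_step x n k k''" for n k k' k''
    using that func_eq[OF assms(1)] child_functional unfolding node_step_def by blast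
qed (use child_om node_step_def in blast)

text \<open>
A node determines its tree, its height, and the path to it.
\<close>

lemma node_disjoint:
  assumes i: "i \<epsilon> tw" and j: "j \<epsilon> tw" and nodes: "node x i n k" "node y j m k"
  shows "n = m \<and> i = j \<and> (\<forall>l. l \<epsilon> n \<longrightarrow> (\<exists>v. pr l v \<epsilon> x \<and> pr l v \<epsilon> y))"
proof -
  let ?P = "\<lambda>n. \<forall>m k. node x i n k \<longrightarrow> node y j m k \<longrightarrow>
    n = m \<and> i = j \<and> (\<forall>l. l \<epsilon> n \<longrightarrow> (\<exists>v. pr l v \<epsilon> x \<and> pr l v \<epsilon> y))"
  have "?P n"
  proof (rule om_induct[of n])
    show "n \<epsilon> om" using node_om[OF nodes(1)] by blast
    show "definable (\<lambda>e. ?P (e 0))" by (intro definability)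
    have root: "\<not> node_step x m k' k" if "k \<epsilon> tw" for x m k k'
      using that child_not_root unfolding node_step_def by blast
    show "?P zer"
    proof (intro allI impI)
      fix m k assume k: "node x i zer k" "node y j m k"
      have "k = i" using node_inv[OF i k(1)] by simp
      then have "m = zer \<and> k = j" using node_inv[OF j k(2)] root i by blast
      then show "zer = m \<and> i = j \<and> (\<forall>l. l \<epsilon> zer \<longrightarrow> (\<exists>v. pr l v \<epsilon> x \<and> pr l v \<epsilon> y))"
        using \<open>k = i\<close> by simp
    qed
    show "?P (sc n)" if IH: "?P n" for n
    proof (intro allI impI)
      fix m k assume k: "node x i (sc n) k" "node y j m k"
      obtain k1 where k1: "node x i n k1" "node_step x n k1 k" using node_inv[OF i k(1)] by auto
      then obtain m2 k2 where k2: "m = sc m2" "node y j m2 k2" "node_step y m2 k2 k"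
        using node_inv[OF j k(2)] root j by blast
      then obtain v w where vw: "pr n v \<epsilon> x" "child k1 v k" "pr m2 w \<epsilon> y" "child k2 w k"
        using k1 unfolding node_step_def by blast
      then have "k1 = k2 \<and> v = w" using child_inject by blast
      then show "sc n = m \<and> i = j \<and> (\<forall>l. l \<epsilon> sc n \<longrightarrow> (\<exists>v. pr l v \<epsilon> x \<and> pr l v \<epsilon> y))"
        using IH k1(1) k2(1,2) vw by auto
    qed
  qed
  then show ?thesis using nodes by blast
qed

end

section \<open>Large sets and branches\<close>

locale countable_base = zf +
  fixes X N
  assumes enum: "bijection N om X"
begin

lemma N_func: "func N om X" and N_inject: "pr x z \<epsilon> N \<Longrightarrow> pr y z \<epsilon> N \<Longrightarrow> x = y"
  and N_surj: "y \<epsilon> X \<Longrightarrow> \<exists>x. pr x y \<epsilon> N"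
  using enum unfolding bijection_def injection_def by auto

lemmas N_mem = func_mem[OF N_func] and N_val = func_val[OF N_func] and N_eq = func_eq[OF N_func]

lemma X_nonempty: "\<exists>z. z \<epsilon> X"
  using N_val[OF zer_om] N_mem by blast

definition univalent :: "'a \<Rightarrow> bool" where
  "univalent r \<longleftrightarrow> (\<forall>z a a'. pr z a \<epsilon> r \<longrightarrow> pr z a' \<epsilon> r \<longrightarrow> a = a')"

text \<open>
The subsets \<open>Y\<close> of \<open>X\<close> that can be mapped onto \<open>X\<close>, which for countable \<open>X\<close> are the infinite ones. The
set \<open>Y\<close> is a set of HOL and need not be represented in the model; only the partial map \<open>q\<close>
has to be. This avoids any separation for the sets that occur below.
\<close>

definition large :: "'a set \<Rightarrow> bool" where
  "large Y \<longleftrightarrow> (\<exists>q. sub q (cart X X) \<and> univalent q \<and> (\<forall>z. z \<epsilon> X \<longrightarrow> (\<exists>y. y \<in> Y \<and> pr y z \<epsilon> q)))"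

definition branch :: "'a \<Rightarrow> 'a \<Rightarrow> 'a set" where
  "branch x i = {z. \<exists>n k. node x i n k \<and> pr k z \<epsilon> N}"

lemma large_mono: "large Y \<Longrightarrow> Y \<subseteq> Z \<Longrightarrow> large Z"
  unfolding large_def by blast

lemma not_large_empty: "\<not> large {}"
  unfolding large_def using X_nonempty by blast

text \<open>
If \<open>q\<close> maps \<open>p\<close> to the element number \<open>c\<close> of \<open>X\<close>, closing the gap by subtracting \<open>1\<close> from all larger numbers
gives a map that does not need \<open>p\<close>.
\<close>

lemma large_insert:
  assumes "large (insert p Y)" shows "large Y"
proof -
  obtain q where q: "sub q (cart X X)" "univalent q" and onto: "\<And>z. z \<epsilon> X \<Longrightarrow> \<exists>y. y \<in> insert p Y \<and> pr y z \<epsilon> q"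
    using assms unfolding large_def by blast
  show ?thesis
  proof (cases "\<exists>v. pr p v \<epsilon> q")
    case False
    then have "\<forall>z. z \<epsilon> X \<longrightarrow> (\<exists>y. y \<in> Y \<and> pr y z \<epsilon> q)" using onto by blast
    then show ?thesis unfolding large_def using q by blast
  next
    case True
    then obtain v where v: "pr p v \<epsilon> q" by blast
    then obtain c where c: "pr c v \<epsilon> N" using N_surj sub_cart[OF q(1)] by blast
    (* elements below number c stay, the others move down by one *)
    define sh where "sh z z' \<longleftrightarrow> (\<exists>m m'. pr m z \<epsilon> N \<and> pr m' z' \<epsilon> N \<and> (m \<epsilon> c \<and> m = m' \<or> \<not> m \<epsilon> c \<and> m = sc m'))" for z z'
    have "\<exists>q'. sub q' (cart X X) \<and> (\<forall>y z. pr y z \<epsilon> q' \<longleftrightarrow> y \<epsilon> X \<and> z \<epsilon> X \<and> (\<exists>w. pr y w \<epsilon> q \<and> sh w z))"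
    by (rule sep_pairs) (unfold sh_def, intro definability)
  then obtain q' where q': "sub q' (cart X X)" "\<And>y z. pr y z \<epsilon> q' \<longleftrightarrow> y \<epsilon> X \<and> z \<epsilon> X \<and> (\<exists>w. pr y w \<epsilon> q \<and> sh w z)"
    by blast
    have "z = z'" if "sh w z" "sh w z'" for w z z'
    proof -
      obtain m m' n n' where "pr m w \<epsilon> N" "pr m' z \<epsilon> N" "m \<epsilon> c \<and> m = m' \<or> \<not> m \<epsilon> c \<and> m = sc m'"
        "pr n w \<epsilon> N" "pr n' z' \<epsilon> N" "n \<epsilon> c \<and> n = n' \<or> \<not> n \<epsilon> c \<and> n = sc n'"
        using \<open>sh w z\<close> \<open>sh w z'\<close> unfolding sh_def by blast
      then show ?thesis using N_inject[of m w n] N_eq[of m' z z'] by auto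
    qed
    then have "univalent q'" using q(2) unfolding univalent_def q'(2) by metis
    moreover have "\<exists>y. y \<in> Y \<and> pr y z \<epsilon> q'" if z: "z \<epsilon> X" for z
    proof -
      obtain m where m: "pr m z \<epsilon> N" using N_surj z by blast
      define m' where "m' = (if m \<epsilon> c then m else sc m)"
      have "m' \<epsilon> om" using N_mem[OF m] unfolding m'_def by auto
      then obtain w where w: "pr m' w \<epsilon> N" using N_val by blast
      then obtain y where y: "y \<in> insert p Y" "pr y w \<epsilon> q" using onto N_mem by blast
      have "c \<epsilon> om" using N_mem[OF c] by blast
      then have *: "m \<epsilon> c" if "sc m \<epsilon> c" using om_trans that by auto
      have "m' \<noteq> c"
        unfolding m'_def using mem_sc[of m m] by auto
      then have "w \<noteq> v" using w c N_inject by blast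
      then have "y \<noteq> p" using y(2) v q(2) unfolding univalent_def by blast
      moreover have "sh w z" unfolding sh_def using w m * unfolding m'_def by (metis (full_types))
      ultimately show ?thesis using y z q'(2) sub_cart[OF q(1)] by blast
    qed
    ultimately show ?thesis unfolding large_def using q'(1) by blast
  qed
qed

lemma large_image:
  assumes "large {z. \<exists>y. y \<in> Y \<and> pr y z \<epsilon> q}" "sub q (cart X X)" "univalent q" shows "large Y"
proof -
  obtain p where p: "sub p (cart X X)" "univalent p"
    and onto: "\<And>w. w \<epsilon> X \<Longrightarrow> \<exists>z. (\<exists>y. y \<in> Y \<and> pr y z \<epsilon> q) \<and> pr z w \<epsilon> p"
    using assms(1) unfolding large_def by blast
  have "\<exists>q'. sub q' (cart X X) \<and> (\<forall>y z. pr y z \<epsilon> q' \<longleftrightarrow> y \<epsilon> X \<and> z \<epsilon> X \<and> (\<exists>w. pr y w \<epsilon> q \<and> pr w z \<epsilon> p))"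
    by (rule sep_pairs) (intro definability)
  then obtain q' where q': "sub q' (cart X X)" "\<And>y z. pr y z \<epsilon> q' \<longleftrightarrow> y \<epsilon> X \<and> z \<epsilon> X \<and> (\<exists>w. pr y w \<epsilon> q \<and> pr w z \<epsilon> p)"
    by blast
  have "univalent q'" using p(2) assms(3) unfolding univalent_def q'(2) by metis
  moreover have "\<forall>w. w \<epsilon> X \<longrightarrow> (\<exists>y. y \<in> Y \<and> pr y w \<epsilon> q')"
    using onto sub_cart[OF assms(2)] unfolding q'(2) by blast
  ultimately show ?thesis unfolding large_def using q'(1) by blast
qed

text \<open>
The nodes of bounded height on a branch form a finite set. Finiteness appears as an induction on the
bound \<open>c\<close>, in which every step adds one node.
\<close>

lemma not_large_initial:
  assumes x: "func x om tw" "i \<epsilon> tw" and c: "c \<epsilon> om"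
  shows "\<not> large {z. \<exists>n k. n \<epsilon> c \<and> node x i n k \<and> pr k z \<epsilon> N}"
  using c
proof (rule om_induct)
  show "definable (\<lambda>e. \<not> large {z. \<exists>n k. n \<epsilon> e 0 \<and> node x i n k \<and> pr k z \<epsilon> N})"
    unfolding large_def univalent_def mem_Collect_eq by (intro definability)
  show "\<not> large {z. \<exists>n k. n \<epsilon> zer \<and> node x i n k \<and> pr k z \<epsilon> N}" using not_large_empty by simp
  fix c assume c: "c \<epsilon> om" and IH: "\<not> large {z. \<exists>n k. n \<epsilon> c \<and> node x i n k \<and> pr k z \<epsilon> N}"
  obtain k where k: "node x i c k" using node_total[OF x c] by blast
  then obtain z where z: "pr k z \<epsilon> N" using N_val node_om by blast
  have "{z. \<exists>n k. n \<epsilon> sc c \<and> node x i n k \<and> pr k z \<epsilon> N} \<subseteq> insert z {z. \<exists>n k. n \<epsilon> c \<and> node x i n k \<and> pr k z \<epsilon> N}"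
    using node_functional[OF x k] N_eq[OF z] by auto
  then show "\<not> large {z. \<exists>n k. n \<epsilon> sc c \<and> node x i n k \<and> pr k z \<epsilon> N}"
    using IH large_insert large_mono by blast
qed

lemma large_branch:
  assumes x: "func x om tw" "i \<epsilon> tw" shows "large (branch x i)"
proof -
  have "\<exists>q. sub q (cart X X) \<and> (\<forall>y z. pr y z \<epsilon> q \<longleftrightarrow> y \<epsilon> X \<and> z \<epsilon> X \<and> (\<exists>n k. node x i n k \<and> pr k y \<epsilon> N \<and> pr n z \<epsilon> N))"
    by (rule sep_pairs) (intro definability)
  then obtain q where q: "sub q (cart X X)" "\<And>y z. pr y z \<epsilon> q \<longleftrightarrow> y \<epsilon> X \<and> z \<epsilon> X \<and> (\<exists>n k. node x i n k \<and> pr k y \<epsilon> N \<and> pr n z \<epsilon> N)"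
    by blast
  have "z = z'" if yz: "pr y z \<epsilon> q" "pr y z' \<epsilon> q" for y z z'
  proof -
    obtain n k n' k' where *: "node x i n k" "pr k y \<epsilon> N" "pr n z \<epsilon> N" "node x i n' k'" "pr k' y \<epsilon> N" "pr n' z' \<epsilon> N"
      using yz unfolding q(2) by blast
    then have "k = k'" using N_inject by blast
    then have "n = n'" using node_disjoint[OF x(2) x(2)] * by blast
    then show ?thesis using * N_eq by blast
  qed
  then have "univalent q" unfolding univalent_def by blast
  moreover have "\<exists>y. y \<in> branch x i \<and> pr y z \<epsilon> q" if z: "z \<epsilon> X" for z
  proof -
    obtain n where n: "pr n z \<epsilon> N" using N_surj z by blast
    then obtain k where k: "node x i n k" using node_total[OF x] N_mem by blast
    then obtain y where "pr k y \<epsilon> N" using N_val node_om by blast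
    then show ?thesis unfolding branch_def q(2) using n k N_mem by blast
  qed
  ultimately show ?thesis unfolding large_def using q(1) by blast
qed

text \<open>
If \<open>x\<close> and \<open>y\<close> differ at \<open>c\<close>, common nodes have height at most \<open>c\<close>.
\<close>

lemma almost_disjoint_branches:
  assumes x: "func x om tw" "i \<epsilon> tw" and y: "func y om tw" "j \<epsilon> tw" and neq: "x \<noteq> y \<or> i \<noteq> j"
  shows "\<not> large (branch x i \<inter> branch y j)"
proof -
  have common: "\<exists>n k. node x i n k \<and> pr k z \<epsilon> N \<and> i = j \<and> (\<forall>l. l \<epsilon> n \<longrightarrow> (\<exists>v. pr l v \<epsilon> x \<and> pr l v \<epsilon> y))"
    if z: "z \<in> branch x i \<inter> branch y j" for z
  proof -
    obtain n k m k' where *: "node x i n k" "pr k z \<epsilon> N" "node y j m k'" "pr k' z \<epsilon> N"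
      using z unfolding branch_def by blast
    then have "k' = k" using N_inject by blast
    then show ?thesis using node_disjoint[OF x(2) y(2)] * by blast
  qed
  show ?thesis
  proof (cases "x = y")
    case True
    then have "branch x i \<inter> branch y j = {}" using neq common by blast
    then show ?thesis using not_large_empty by simp
  next
    case False
    then obtain c v w where c: "pr c v \<epsilon> x" "pr c w \<epsilon> y" "v \<noteq> w" using func_differ[OF x(1) y(1)] by blast
    then have "c \<epsilon> om" using func_mem[OF x(1)] by blast
    have "branch x i \<inter> branch y j \<subseteq> {z. \<exists>n k. n \<epsilon> sc c \<and> node x i n k \<and> pr k z \<epsilon> N}"
    proof
      fix z assume "z \<in> branch x i \<inter> branch y j"
      from common[OF this] obtain n k where n: "node x i n k" "pr k z \<epsilon> N"
        "\<And>l. l \<epsilon> n \<Longrightarrow> \<exists>v. pr l v \<epsilon> x \<and> pr l v \<epsilon> y" by blast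
      have "\<not> c \<epsilon> n" using n(3)[of c] c func_eq[OF x(1)] func_eq[OF y(1)] by blast
      then have "n \<epsilon> sc c" using om_linear[of c n] node_om[OF n(1)] \<open>c \<epsilon> om\<close> by auto
      then show "z \<in> {z. \<exists>n k. n \<epsilon> sc c \<and> node x i n k \<and> pr k z \<epsilon> N}" using n by blast
    qed
    then show ?thesis using not_large_initial[OF x sc_om[OF \<open>c \<epsilon> om\<close>]] large_mono by blast
  qed
qed

section \<open>Composition in clones\<close>

text \<open>
The 1-tuple \<open>{(0, y)}\<close>: arguments of unary operations are functions on \<open>1 = {0}\<close>.
\<close>

definition tup :: "'a \<Rightarrow> 'a" where
  "tup y = up (pr zer y) (pr zer y)"

lemma definable_term_tup [definability]: "definable_term t \<Longrightarrow> definable_term (\<lambda>e. tup (t e))"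
  unfolding tup_def by (intro definability)

lemma mem_tup [simp]: "p \<epsilon> tup y \<longleftrightarrow> p = pr zer y"
  unfolding tup_def by simp

lemma tup_inject [simp]: "tup y = tup z \<longleftrightarrow> y = z"
  by (metis mem_tup pr_inject)

lemma func_tup: "y \<epsilon> A \<Longrightarrow> func (tup y) one A"
  unfolding func_iff by (simp add: sub_def)

lemma func_one:
  assumes "func a one A" obtains y where "y \<epsilon> A" "a = tup y"
proof -
  obtain y where y: "pr zer y \<epsilon> a" using func_val[OF assms] by auto
  then have "y \<epsilon> A" using func_mem[OF assms] by blast
  then have "tup y = a" by (rule func_ext[OF func_tup assms]) (use y in auto)
  then show ?thesis using that \<open>y \<epsilon> A\<close> by blast
qed

lemma arity_one: "arity one"
  by (simp add: arity_iff)

lemma projection_iff: "projection X f \<longleftrightarrow>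
    (\<exists>n i. arity n \<and> i \<epsilon> n \<and> func f (fs n X) X \<and>
      (\<forall>a. func a n X \<longrightarrow> (\<exists>y. pr i y \<epsilon> a \<and> pr a y \<epsilon> f)))"
  unfolding projection_def by simp

lemma composite_iff: "composite X n m f g h \<longleftrightarrow> func h (fs m X) X \<and>
    (\<forall>a. func a m X \<longrightarrow> (\<exists>b y. func b n X \<and>
       (\<forall>i. i \<epsilon> n \<longrightarrow> (\<exists>k z. pr i k \<epsilon> g \<and> pr a z \<epsilon> k \<and> pr i z \<epsilon> b)) \<and> pr b y \<epsilon> f \<and> pr a y \<epsilon> h))"
  unfolding composite_def by simp

lemma clone_iff: "clone X C \<longleftrightarrow> sub C (ops X) \<and> (\<forall>f. projection X f \<longrightarrow> f \<epsilon> C) \<and>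
    (\<forall>n m f g h. arity n \<and> arity m \<and> f \<epsilon> C \<and> func f (fs n X) X \<and> func g n C \<and>
      (\<forall>i k. pr i k \<epsilon> g \<longrightarrow> func k (fs m X) X) \<and> composite X n m f g h \<longrightarrow> h \<epsilon> C)"
  unfolding clone_def sub_def by simp

lemma clone_composite:
  assumes "clone X C" "arity n" "arity m" "f \<epsilon> C" "func f (fs n X) X" "func g n C"
    "\<And>i k. pr i k \<epsilon> g \<Longrightarrow> func k (fs m X) X" "composite X n m f g h"
  shows "h \<epsilon> C"
  using assms unfolding clone_iff by blast

section \<open>The clone of an ideal\<close>

text \<open>
The ideal of the sets with small intersection with every branch selected by \<open>s\<close>.
\<close>

definition in_ideal :: "'a \<Rightarrow> 'a set \<Rightarrow> bool" where
  "in_ideal s Y \<longleftrightarrow> (\<forall>x i. pr x i \<epsilon> s \<longrightarrow> \<not> large (Y \<inter> branch x i))"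

text \<open>
A family \<open>r\<close> of tuples \<open>(a\<^sub>z)\<close>, indexed by elements \<open>z\<close> of \<open>X\<close>, is seen as a matrix with the rows \<open>a\<^sub>z\<close>: \<open>col r i\<close> is the
set of the entries \<open>a\<^sub>z(i)\<close> of its \<open>i\<close>-th column, and \<open>img f r\<close> the set of the values \<open>f(a\<^sub>z)\<close>.
\<close>

definition col :: "'a \<Rightarrow> 'a \<Rightarrow> 'a set" where
  "col r i = {y. \<exists>z a. z \<epsilon> X \<and> pr z a \<epsilon> r \<and> pr i y \<epsilon> a}"

definition img :: "'a \<Rightarrow> 'a \<Rightarrow> 'a set" where
  "img f r = {y. \<exists>z a. z \<epsilon> X \<and> pr z a \<epsilon> r \<and> pr a y \<epsilon> f}"

text \<open>
No arity is mentioned: rows of a wrong length are not in the domain of \<open>f\<close> and do not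
contribute to \<open>img f r\<close>.
\<close>

definition preserves :: "'a \<Rightarrow> 'a \<Rightarrow> bool" where
  "preserves s f \<longleftrightarrow> (\<forall>r. univalent r \<longrightarrow> (\<forall>i. in_ideal s (col r i)) \<longrightarrow> in_ideal s (img f r))"

abbreviation R :: 'a where "R \<equiv> fs om tw"
abbreviation S :: 'a where "S \<equiv> fs R tw"

lemma in_ideal_mono: "in_ideal s Y \<Longrightarrow> Z \<subseteq> Y \<Longrightarrow> in_ideal s Z"
  unfolding in_ideal_def by (meson Int_mono large_mono subset_refl)

lemma in_ideal_empty: "in_ideal s {}"
  unfolding in_ideal_def using not_large_empty by simp

lemma definable_preserves [definability]: "definable_term s \<Longrightarrow> definable_term f \<Longrightarrow> definable (\<lambda>e. preserves (s e) (f e))"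
  by (rule definable_subst2[where P = preserves], unfold preserves_def in_ideal_def large_def univalent_def col_def img_def
      branch_def Int_iff mem_Collect_eq) (intro definability | assumption)+

definition ideal_clone :: "'a \<Rightarrow> 'a" where
  "ideal_clone s = sep (ops X) (preserves s)"

lemma mem_ideal_clone [simp]: "f \<epsilon> ideal_clone s \<longleftrightarrow> operation X f \<and> preserves s f"
proof -
  have "definable (\<lambda>e. preserves s (e 0))" by (intro definability)
  from mem_sep[OF this] show ?thesis unfolding ideal_clone_def by simp
qed

text \<open>
For a composite \<open>f(g\<^sub>0, \<dots>, g\<^bsub>n-1\<^esub>)\<close>, applying the operations \<open>g\<^sub>i\<close> to the rows of a matrix gives a
matrix whose columns are images under the \<open>g\<^sub>i\<close>, hence in the ideal.
\<close>

lemma clone_ideal_clone: "clone X (ideal_clone s)"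
  unfolding clone_iff
proof (intro conjI allI impI)
  show "sub (ideal_clone s) (ops X)" by (simp add: sub_def)
next
  fix f assume "projection X f"
  then obtain n i where n: "arity n" "func f (fs n X) X"
    and f: "\<And>a. func a n X \<Longrightarrow> \<exists>y. pr i y \<epsilon> a \<and> pr a y \<epsilon> f"
    unfolding projection_iff by blast
  have "img f r \<subseteq> col r i" for r
  proof
    fix y assume "y \<in> img f r"
    then obtain z a where z: "z \<epsilon> X" "pr z a \<epsilon> r" "pr a y \<epsilon> f" unfolding img_def by blast
    then have "func a n X" using func_mem[OF n(2)] by auto
    then have "pr i y \<epsilon> a" using f func_eq[OF n(2)] z(3) by blast
    then show "y \<in> col r i" unfolding col_def using z by blast
  qed
  then have "preserves s f" unfolding preserves_def using in_ideal_mono by blast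
  then show "f \<epsilon> ideal_clone s" using n unfolding mem_ideal_clone operation_iff by blast
next
  fix n m f g h
  assume a: "arity n \<and> arity m \<and> f \<epsilon> ideal_clone s \<and> func f (fs n X) X \<and> func g n (ideal_clone s) \<and>
      (\<forall>i k. pr i k \<epsilon> g \<longrightarrow> func k (fs m X) X) \<and> composite X n m f g h"
  then have f: "func f (fs n X) X" "preserves s f" and g: "func g n (ideal_clone s)" and m: "arity m"
    and k: "\<And>i k. pr i k \<epsilon> g \<Longrightarrow> func k (fs m X) X" and h: "func h (fs m X) X"
    and comp: "\<And>a. func a m X \<Longrightarrow> \<exists>b y. func b n X \<and>
       (\<forall>i. i \<epsilon> n \<longrightarrow> (\<exists>k z. pr i k \<epsilon> g \<and> pr a z \<epsilon> k \<and> pr i z \<epsilon> b)) \<and> pr b y \<epsilon> f \<and> pr a y \<epsilon> h"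
    unfolding composite_iff by auto
  have gC: "preserves s k" if "pr i k \<epsilon> g" for i k using func_mem[OF g that] by simp
  have "preserves s h" unfolding preserves_def
  proof (intro allI impI)
    fix r assume r: "univalent r" "\<forall>i. in_ideal s (col r i)"
    let ?Q = "\<lambda>a b. func a m X \<and> func b n X \<and> (\<forall>i. i \<epsilon> n \<longrightarrow> (\<exists>k z. pr i k \<epsilon> g \<and> pr a z \<epsilon> k \<and> pr i z \<epsilon> b))"
    have "\<exists>r'. sub r' (cart X (fs n X)) \<and> (\<forall>z b. pr z b \<epsilon> r' \<longleftrightarrow> z \<epsilon> X \<and> b \<epsilon> fs n X \<and> (\<exists>a. pr z a \<epsilon> r \<and> ?Q a b))"
      by (rule sep_pairs) (intro definability)
    then obtain r' where r': "\<And>z b. pr z b \<epsilon> r' \<longleftrightarrow> z \<epsilon> X \<and> b \<epsilon> fs n X \<and> (\<exists>a. pr z a \<epsilon> r \<and> ?Q a b)"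
      by blast
    have uniq: "b = b'" if Q: "?Q a b" "?Q a b'" for a b b'
    proof (rule func_ext[of b n X b' X])
      fix i y assume iy: "pr i y \<epsilon> b"
      then have "i \<epsilon> n" using func_mem Q by blast
      then obtain k z k' z' where *: "pr i k \<epsilon> g" "pr a z \<epsilon> k" "pr i z \<epsilon> b" "pr i k' \<epsilon> g" "pr a z' \<epsilon> k'" "pr i z' \<epsilon> b'"
        using Q by blast
      then have "k' = k" using func_eq[OF g] by blast
      then have "z' = z" using func_eq[OF k] * by blast
      moreover have "y = z" using func_eq iy *(3) Q by blast
      ultimately show "pr i y \<epsilon> b'" using * by simp
    qed (use Q in auto)
    have "univalent r'" unfolding univalent_def r' using uniq r(1) unfolding univalent_def by blast
    moreover have "in_ideal s (col r' i)" for i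
    proof (cases "i \<epsilon> n")
      case True
      then obtain k0 where k0: "pr i k0 \<epsilon> g" using func_val[OF g] by blast
      have "col r' i \<subseteq> img k0 r"
      proof
        fix y assume "y \<in> col r' i"
        then obtain z b a where z: "z \<epsilon> X" "pr i y \<epsilon> b" "pr z a \<epsilon> r" "?Q a b" unfolding col_def r' by blast
        then obtain k1 w where w: "pr i k1 \<epsilon> g" "pr a w \<epsilon> k1" "pr i w \<epsilon> b" using True by blast
        have "k1 = k0" using func_eq[OF g] w k0 by blast
        moreover have "y = w" using func_eq z w by blast
        ultimately show "y \<in> img k0 r" unfolding img_def using z w by blast
      qed
      moreover have "in_ideal s (img k0 r)" using gC[OF k0] r unfolding preserves_def by blast
      ultimately show ?thesis using in_ideal_mono by blast
    next
      case False
      have "col r' i = {}" unfolding col_def r' using func_mem False by blast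
      then show ?thesis using in_ideal_empty by simp
    qed
    ultimately have "in_ideal s (img f r')" using f(2) unfolding preserves_def by blast
    moreover have "img h r \<subseteq> img f r'"
    proof
      fix y assume "y \<in> img h r"
      then obtain z a where z: "z \<epsilon> X" "pr z a \<epsilon> r" "pr a y \<epsilon> h" unfolding img_def by blast
      then have am: "func a m X" using func_mem[OF h] by auto
      then obtain b w where b: "?Q a b" "pr b w \<epsilon> f" "pr a w \<epsilon> h" using comp by blast
      then have "w = y" using func_eq[OF h] z by blast
      moreover have "pr z b \<epsilon> r'" unfolding r' using z b by auto
      ultimately show "y \<in> img f r'" unfolding img_def using z b by blast
    qed
    ultimately show "in_ideal s (img h r)" using in_ideal_mono by blast
  qed
  then show "h \<epsilon> ideal_clone s" using h m unfolding mem_ideal_clone operation_iff by blast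
qed

text \<open>
A large part \<open>Y\<close> of a branch can be stretched to \<open>X\<close> by an operation that is constant outside the branch. Such
an operation maps \<open>B\<close> to the image of \<open>B \<inter> branch x i\<close> and one more point. So, if
\<open>s\<close> selects this branch, it maps every \<open>B\<close> in the ideal of \<open>s\<close> to a set that is not large.
\<close>

lemma stretch:
  assumes large: "large Y" and Y: "Y \<subseteq> branch x i"
  shows "\<exists>u. func u (fs one X) X \<and> (\<forall>z. z \<epsilon> X \<longrightarrow> (\<exists>y. y \<in> Y \<and> y \<epsilon> X \<and> pr (tup y) z \<epsilon> u)) \<and>
    (\<forall>s. pr x i \<epsilon> s \<longrightarrow> preserves s u)"
proof -
  obtain q where q: "sub q (cart X X)" "univalent q" and onto: "\<And>z. z \<epsilon> X \<Longrightarrow> \<exists>y. y \<in> Y \<and> pr y z \<epsilon> q"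
    using large unfolding large_def by blast
  obtain p where p: "p \<epsilon> X" using X_nonempty by blast
  let ?b = "\<lambda>y. \<exists>n k. node x i n k \<and> pr k y \<epsilon> N"
  have b: "?b y \<longleftrightarrow> y \<in> branch x i" for y unfolding branch_def by simp
  let ?Q = "\<lambda>y z. (?b y \<and> pr y z \<epsilon> q) \<or> ((\<nexists>w. ?b y \<and> pr y w \<epsilon> q) \<and> z = p)"
  have "\<exists>u. sub u (cart (fs one X) X) \<and> (\<forall>a z. pr a z \<epsilon> u \<longleftrightarrow> a \<epsilon> fs one X \<and> z \<epsilon> X \<and> (\<exists>y. a = tup y \<and> ?Q y z))"
    by (rule sep_pairs) (intro definability)
  then obtain u where sub: "sub u (cart (fs one X) X)"
    and u0: "\<And>a z. pr a z \<epsilon> u \<longleftrightarrow> a \<epsilon> fs one X \<and> z \<epsilon> X \<and> (\<exists>y. a = tup y \<and> ?Q y z)"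
    by blast
  let ?Q' = "\<lambda>y z. (y \<in> branch x i \<and> pr y z \<epsilon> q) \<or> ((\<nexists>w. y \<in> branch x i \<and> pr y w \<epsilon> q) \<and> z = p)"
  have u: "pr a z \<epsilon> u \<longleftrightarrow> a \<epsilon> fs one X \<and> z \<epsilon> X \<and> (\<exists>y. a = tup y \<and> ?Q' y z)" for a z
    unfolding u0 b ..
  have "func u (fs one X) X"
  proof (rule funcI[OF sub])
    fix a assume a: "a \<epsilon> fs one X"
    then obtain y where "a = tup y" using func_one mem_fs by metis
    then show "\<exists>z. pr a z \<epsilon> u" unfolding u using p a sub_cart[OF q(1)] by (cases "\<exists>w. y \<in> branch x i \<and> pr y w \<epsilon> q") blast+
  next
    fix a z z' assume "pr a z \<epsilon> u" "pr a z' \<epsilon> u"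
    then obtain y where "?Q' y z" "?Q' y z'" unfolding u using tup_inject by metis
    then show "z = z'" using q(2) unfolding univalent_def by blast
  qed
  moreover have "\<exists>y. y \<in> Y \<and> y \<epsilon> X \<and> pr (tup y) z \<epsilon> u" if z: "z \<epsilon> X" for z
  proof -
    obtain y where y: "y \<in> Y" "pr y z \<epsilon> q" using onto[OF z] by blast
    then have "y \<epsilon> X" using sub_cart[OF q(1)] by blast
    then have "func (tup y) one X" by (rule func_tup)
    then show ?thesis unfolding u mem_fs using y z Y \<open>y \<epsilon> X\<close> by blast
  qed
  moreover have "preserves s u" if s: "pr x i \<epsilon> s" for s
    unfolding preserves_def
  proof (intro allI impI)
    fix r assume r: "univalent r" "\<forall>i. in_ideal s (col r i)"
    define B where "B = col r zer \<inter> branch x i"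
    have "\<not> large B" using r(2) s unfolding in_ideal_def B_def by blast
    then have B: "\<not> large (insert p {z. \<exists>y. y \<in> B \<and> pr y z \<epsilon> q})" using large_insert large_image q by blast
    have "img u r \<subseteq> insert p {z. \<exists>y. y \<in> B \<and> pr y z \<epsilon> q}"
    proof
      fix w assume "w \<in> img u r"
      then obtain z y where z: "z \<epsilon> X" "pr z (tup y) \<epsilon> r" "?Q' y w" unfolding img_def u by blast
      then have "y \<in> col r zer" unfolding col_def using mem_tup by blast
      then show "w \<in> insert p {z. \<exists>y. y \<in> B \<and> pr y z \<epsilon> q}" using z(3) unfolding B_def by blast
    qed
    then have "\<not> large (img u r \<inter> A)" for A using B large_mono by blast
    then show "in_ideal s (img u r)" unfolding in_ideal_def by blast
  qed
  ultimately show ?thesis by blast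
qed

text \<open>
The operation stretches the whole branch \<open>(x, i)\<close>. This branch is in the ideal of \<open>s\<close> unless \<open>s\<close> selects
it, while \<open>X\<close> is never in the ideal of \<open>s\<close>.
\<close>

lemma separating_operation:
  assumes x: "x \<epsilon> R" and i: "i \<epsilon> tw"
  shows "\<exists>u. func u (fs one X) X \<and>
    (\<forall>s. s \<epsilon> S \<longrightarrow> pr x i \<epsilon> s \<longrightarrow> preserves s u) \<and> (\<forall>s. s \<epsilon> S \<longrightarrow> \<not> pr x i \<epsilon> s \<longrightarrow> \<not> preserves s u)"
proof -
  have fx: "func x om tw" using x by simp
  obtain u where u: "func u (fs one X) X" "\<And>s. pr x i \<epsilon> s \<Longrightarrow> preserves s u"
    and onto: "\<And>z. z \<epsilon> X \<Longrightarrow> \<exists>y. y \<in> branch x i \<and> y \<epsilon> X \<and> pr (tup y) z \<epsilon> u"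
    using stretch[OF large_branch[OF fx i] subset_refl] by blast
  have "\<exists>r. sub r (cart X (fs one X)) \<and> (\<forall>y a. pr y a \<epsilon> r \<longleftrightarrow> y \<epsilon> X \<and> a \<epsilon> fs one X \<and>
      ((\<exists>n k. node x i n k \<and> pr k y \<epsilon> N) \<and> a = tup y))"
    by (rule sep_pairs) (intro definability)
  then obtain r where r: "\<And>y a. pr y a \<epsilon> r \<longleftrightarrow> y \<epsilon> X \<and> a \<epsilon> fs one X \<and> y \<in> branch x i \<and> a = tup y"
    unfolding branch_def by auto
  have "univalent r" unfolding univalent_def r by blast
  have col: "col r k \<subseteq> branch x i" for k unfolding col_def r by auto
  have img: "z \<in> img u r" if z: "z \<epsilon> X" for z
    using onto[OF z] func_tup unfolding img_def r by auto
  have "\<not> preserves s u" if s: "s \<epsilon> S" "\<not> pr x i \<epsilon> s" for s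
  proof
    assume preserves: "preserves s u"
    have fs: "func s R tw" using s by simp
    obtain j where j: "pr x j \<epsilon> s" using func_val[OF fs x] by blast
    have "in_ideal s (branch x i)" unfolding in_ideal_def
    proof (intro allI impI)
      fix y k assume yk: "pr y k \<epsilon> s"
      then have "func y om tw" "k \<epsilon> tw" using func_mem[OF fs yk] by auto
      then show "\<not> large (branch x i \<inter> branch y k)"
        by (rule almost_disjoint_branches[OF fx i]) (use yk s in blast)
    qed
    then have "in_ideal s (img u r)" using preserves \<open>univalent r\<close> col in_ideal_mono unfolding preserves_def by blast
    then have "\<not> large (img u r \<inter> branch x j)" using j unfolding in_ideal_def by blast
    moreover have "branch x j \<subseteq> img u r" using img N_mem unfolding branch_def by blast
    moreover have "large (branch x j)" using large_branch[OF fx] func_mem[OF fs j] by blast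
    ultimately show False by (simp add: Int_absorb1)
  qed
  then show ?thesis using u by blast
qed

lemma ideal_clone_proper:
  assumes s: "s \<epsilon> S" shows "ideal_clone s \<noteq> ops X"
proof -
  have fs: "func s R tw" using s by simp
  have "\<exists>x. sub x (cart om tw) \<and> (\<forall>n j. pr n j \<epsilon> x \<longleftrightarrow> n \<epsilon> om \<and> j \<epsilon> tw \<and> j = zer)"
    by (rule sep_pairs) (intro definability)
  then obtain x where "sub x (cart om tw)" "\<And>n j. pr n j \<epsilon> x \<longleftrightarrow> n \<epsilon> om \<and> j \<epsilon> tw \<and> j = zer" by blast
  then have "func x om tw" by (intro funcI) auto
  then have x: "x \<epsilon> R" by simp
  obtain i where i: "pr x i \<epsilon> s" using func_val[OF fs x] by blast
  define j where "j = (if i = zer then one else zer)"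
  have "i \<noteq> j" by (simp add: j_def)
  then have "\<not> pr x j \<epsilon> s" using func_eq[OF fs i] by blast
  moreover have "j \<epsilon> tw" by (simp add: j_def)
  ultimately obtain u where "func u (fs one X) X" "\<not> preserves s u"
    using separating_operation[OF x] s by blast
  then have "u \<epsilon> ops X" "\<not> u \<epsilon> ideal_clone s" unfolding mem_ops mem_ideal_clone operation_iff using arity_one by blast+
  then show ?thesis by metis
qed

lemma ideal_clone_inject:
  assumes s: "s \<epsilon> S" "s' \<epsilon> S" and eq: "ideal_clone s = ideal_clone s'" shows "s = s'"
proof (rule ccontr)
  assume neq: "s \<noteq> s'"
  have fs: "func s R tw" "func s' R tw" using s by simp_all
  obtain x i j where xi: "pr x i \<epsilon> s" "pr x j \<epsilon> s'" "i \<noteq> j" using func_differ[OF fs neq] by blast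
  have x: "x \<epsilon> R" "i \<epsilon> tw" using func_mem[OF fs(1) xi(1)] by blast+
  have "\<not> pr x i \<epsilon> s'" using func_eq[OF fs(2) xi(2)] xi(3) by blast
  then obtain u where u: "func u (fs one X) X" "preserves s u" "\<not> preserves s' u"
    using separating_operation[OF x] s xi(1) by blast
  then have "u \<epsilon> ideal_clone s" "\<not> u \<epsilon> ideal_clone s'" unfolding mem_ideal_clone operation_iff using arity_one by blast+
  then show False using eq by simp
qed

text \<open>
A matrix \<open>r\<close> witnesses that some \<open>h \<in> K\<close> does not preserve the ideal of \<open>s\<close>. Stretching \<open>img h r\<close> to \<open>X\<close> by \<open>u\<close>
and choosing rows, one gets \<open>z = u(h(row z))\<close> for all \<open>z \<in> X\<close>. Then any \<open>g\<close> is the composite of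
\<open>u\<close>, \<open>h\<close> and the operations that map \<open>c\<close> to the entries of \<open>row (g c)\<close>; their ranges are
contained in columns of \<open>r\<close>, so they preserve the ideal.
\<close>

lemma clone_above_ideal_clone:
  assumes clone: "clone X K" and CK: "sub (ideal_clone s) K" "ideal_clone s \<noteq> K"
  shows "K = ops X"
proof (rule sub_antisym)
  show Kops: "sub K (ops X)" using clone unfolding clone_iff by blast
  obtain h where h: "h \<epsilon> K" "\<not> h \<epsilon> ideal_clone s" using CK sub_antisym[OF CK(1)] unfolding sub_def by blast
  then have hop: "operation X h" using Kops unfolding sub_def mem_ops by blast
  then obtain n where n: "arity n" "func h (fs n X) X" unfolding operation_iff by blast
  have "\<not> preserves s h" using h(2) hop by simp
  then obtain r where r: "univalent r" "\<And>i. in_ideal s (col r i)" "\<not> in_ideal s (img h r)"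
    unfolding preserves_def by blast
  obtain x i where xi: "pr x i \<epsilon> s" "large (img h r \<inter> branch x i)" using r(3) unfolding in_ideal_def by blast
  obtain u where u: "func u (fs one X) X" "preserves s u"
    and onto: "\<And>z. z \<epsilon> X \<Longrightarrow> \<exists>y. y \<in> img h r \<inter> branch x i \<and> pr (tup y) z \<epsilon> u"
    using stretch[OF xi(2)] xi(1) by blast
  have uK: "u \<epsilon> K" using u arity_one CK(1) unfolding sub_def mem_ideal_clone operation_iff by blast
  let ?Q = "\<lambda>z w. \<exists>a y. pr w a \<epsilon> r \<and> pr a y \<epsilon> h \<and> pr (tup y) z \<epsilon> u"
  have DQ: "definable (\<lambda>e. ?Q (e 0) (e 1))" by (intro definability)
  have exQ: "\<exists>w. w \<epsilon> X \<and> ?Q z w" if "z \<epsilon> X" for z using onto[OF that] unfolding img_def by blast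
  obtain t where t: "func t X X" and tQ: "\<And>z w. pr z w \<epsilon> t \<Longrightarrow> ?Q z w"
    using section_exists[OF enum, of ?Q thesis] DQ exQ by blast
  define row where "row z a \<longleftrightarrow> (\<exists>w. pr z w \<epsilon> t \<and> pr w a \<epsilon> r)" for z a
  have row: "\<exists>a y. row z a \<and> func a n X \<and> pr a y \<epsilon> h \<and> pr (tup y) z \<epsilon> u" if z: "z \<epsilon> X" for z
  proof -
    obtain w where w: "pr z w \<epsilon> t" using func_val[OF t z] by blast
    then obtain a y where "pr w a \<epsilon> r" "pr a y \<epsilon> h" "pr (tup y) z \<epsilon> u" using tQ by blast
    moreover from this have "func a n X" using func_mem[OF n(2)] by auto
    ultimately show ?thesis unfolding row_def using w by blast
  qed
  have row_eq: "a = a'" if a: "row z a" "row z a'" for z a a'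
  proof -
    obtain w w' where w: "pr z w \<epsilon> t" "pr w a \<epsilon> r" "pr z w' \<epsilon> t" "pr w' a' \<epsilon> r" using a unfolding row_def by blast
    then have "w = w'" using func_eq[OF t] by blast
    then show ?thesis using w r(1) unfolding univalent_def by blast
  qed
  have row_col: "y \<in> col r i" if a: "row z a" "pr i y \<epsilon> a" for z a i y
    using a func_mem[OF t] unfolding row_def col_def by blast
  have definable_row: "definable_term z \<Longrightarrow> definable_term a \<Longrightarrow> definable (\<lambda>e. row (z e) (a e))" for z a
    by (rule definable_subst2[where P = row], unfold row_def) (intro definability | assumption)+
  show "sub (ops X) K" unfolding sub_def mem_ops
  proof (intro allI impI)
    fix g assume "operation X g"
    then obtain m where m: "arity m" "func g (fs m X) X" unfolding operation_iff by blast
    have row_g: "\<exists>z a y. pr c z \<epsilon> g \<and> row z a \<and> func a n X \<and> pr a y \<epsilon> h \<and> pr (tup y) z \<epsilon> u" if c: "func c m X" for c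
    proof -
      obtain z where z: "pr c z \<epsilon> g" using func_val[OF m(2)] c by auto
      then show ?thesis using row func_mem[OF m(2)] by blast
    qed
    (* the operation of K that maps c to the i-th entry of row (g c) *)
    define comp where "comp i k \<longleftrightarrow> sub k (cart (fs m X) X) \<and> (\<forall>c y. pr c y \<epsilon> k \<longleftrightarrow> c \<epsilon> fs m X \<and> y \<epsilon> X \<and>
      (\<exists>z a. pr c z \<epsilon> g \<and> row z a \<and> pr i y \<epsilon> a))" for i k
    have comp_ex: "\<exists>k. comp i k" for i
      unfolding comp_def by (rule sep_pairs) (intro definability definable_row)
    have comp_func: "func k (fs m X) X" if i: "i \<epsilon> n" and k: "comp i k" for i k
    proof (rule funcI)
      show "sub k (cart (fs m X) X)" using k unfolding comp_def by blast
      fix c assume c: "c \<epsilon> fs m X"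
      then obtain z a where a: "pr c z \<epsilon> g" "row z a" "func a n X" using row_g[of c] by auto
      then obtain y where "pr i y \<epsilon> a" using func_val i by blast
      then show "\<exists>y. pr c y \<epsilon> k" using k a c func_mem[OF a(3)] unfolding comp_def by blast
    next
      fix c y y' assume "pr c y \<epsilon> k" "pr c y' \<epsilon> k"
      then obtain z a z' a' where *: "func c m X" "pr c z \<epsilon> g" "row z a" "pr i y \<epsilon> a" "pr c z' \<epsilon> g" "row z' a'" "pr i y' \<epsilon> a'"
        using k unfolding comp_def by auto
      then have "z' = z" using func_eq[OF m(2)] by blast
      then have "a' = a" using row_eq * by blast
      obtain z1 a1 where **: "pr c z1 \<epsilon> g" "row z1 a1" "func a1 n X" using row_g[OF *(1)] by blast
      then have "z1 = z" using func_eq[OF m(2)] * by blast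
      then have "func a n X" using ** row_eq * by blast
      then show "y = y'" using func_eq * \<open>a' = a\<close> by blast
    qed
    have comp_ideal_clone: "k \<epsilon> ideal_clone s" if i: "i \<epsilon> n" and k: "comp i k" for i k
    proof -
      have "img k r' \<subseteq> col r i" for r' using k row_col unfolding img_def comp_def by blast
      then have "preserves s k" unfolding preserves_def using r(2) in_ideal_mono by blast
      then show ?thesis using comp_func[OF i k] m(1) unfolding mem_ideal_clone operation_iff by blast
    qed
    have comp_eq: "k = k'" if k: "comp i k" "comp i k'" for i k k'
    proof -
      have "sub k k'" if "comp i k" "comp i k'" for k k'
        using that unfolding comp_def sub_def mem_cart by blast
      then show ?thesis using k by (blast intro: sub_antisym)
    qed
    have "\<exists>G. sub G (cart n K) \<and> (\<forall>i k. pr i k \<epsilon> G \<longleftrightarrow> i \<epsilon> n \<and> k \<epsilon> K \<and> comp i k)"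
      by (rule sep_pairs, unfold comp_def) (intro definability definable_row)
    then obtain G where G: "sub G (cart n K)" "\<And>i k. pr i k \<epsilon> G \<longleftrightarrow> i \<epsilon> n \<and> k \<epsilon> K \<and> comp i k" by blast
    have compG: "\<exists>k. pr i k \<epsilon> G \<and> comp i k" if i: "i \<epsilon> n" for i
      unfolding G(2) using comp_ex[of i] comp_ideal_clone[OF i] CK(1) i unfolding sub_def by blast
    have "func G n K" by (rule funcI[OF G(1)]) (use compG comp_eq G(2) in blast)+
    have "\<exists>h'. sub h' (cart (fs m X) X) \<and> (\<forall>c y. pr c y \<epsilon> h' \<longleftrightarrow> c \<epsilon> fs m X \<and> y \<epsilon> X \<and>
      (\<exists>z a. pr c z \<epsilon> g \<and> row z a \<and> pr a y \<epsilon> h))"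
      by (rule sep_pairs) (intro definability definable_row)
    then obtain h' where h': "sub h' (cart (fs m X) X)" "\<And>c y. pr c y \<epsilon> h' \<longleftrightarrow> c \<epsilon> fs m X \<and> y \<epsilon> X \<and>
      (\<exists>z a. pr c z \<epsilon> g \<and> row z a \<and> pr a y \<epsilon> h)" by blast
    have h'_func: "func h' (fs m X) X"
    proof (rule funcI[OF h'(1)])
      fix c assume "c \<epsilon> fs m X"
      then show "\<exists>y. pr c y \<epsilon> h'" unfolding h'(2) using row_g[of c] func_mem[OF n(2)] by auto
    next
      fix c y y' assume "pr c y \<epsilon> h'" "pr c y' \<epsilon> h'"
      then obtain z a z' a' where *: "pr c z \<epsilon> g" "row z a" "pr a y \<epsilon> h" "pr c z' \<epsilon> g" "row z' a'" "pr a' y' \<epsilon> h"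
        unfolding h'(2) by blast
      then have "z' = z" using func_eq[OF m(2)] by blast
      then have "a' = a" using row_eq * by blast
      then show "y = y'" using func_eq[OF n(2)] * by blast
    qed
    have "composite X n m h G h'" unfolding composite_iff
    proof (intro conjI allI impI h'_func)
      fix c assume c: "func c m X"
      obtain z a y where z: "pr c z \<epsilon> g" "row z a" "func a n X" "pr a y \<epsilon> h" using row_g[OF c] by blast
      have "\<exists>k w. pr i k \<epsilon> G \<and> pr c w \<epsilon> k \<and> pr i w \<epsilon> a" if i: "i \<epsilon> n" for i
      proof -
        obtain k where k: "pr i k \<epsilon> G" "comp i k" using compG[OF i] by blast
        obtain w where w: "pr i w \<epsilon> a" using func_val[OF z(3) i] by blast
        then have "pr c w \<epsilon> k" using k(2) z c func_mem[OF z(3) w] unfolding comp_def by auto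
        then show ?thesis using k w by blast
      qed
      moreover have "pr c y \<epsilon> h'" unfolding h'(2) using c z func_mem[OF n(2)] by auto
      ultimately show "\<exists>b y. func b n X \<and> (\<forall>i. i \<epsilon> n \<longrightarrow> (\<exists>k w. pr i k \<epsilon> G \<and> pr c w \<epsilon> k \<and> pr i w \<epsilon> b)) \<and> pr b y \<epsilon> h \<and> pr c y \<epsilon> h'"
        using z by blast
    qed
    then have "h' \<epsilon> K"
      by (rule clone_composite[OF clone n(1) m(1) h(1) n(2) \<open>func G n K\<close>, rotated]) (use G(2) comp_func in blast)
    have "composite X one m u (tup h') g" unfolding composite_iff
    proof (intro conjI allI impI m(2))
      fix c assume c: "func c m X"
      obtain z a y where z: "pr c z \<epsilon> g" "row z a" "pr a y \<epsilon> h" "pr (tup y) z \<epsilon> u" using row_g[OF c] by blast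
      have "pr c y \<epsilon> h'" unfolding h'(2) using c z func_mem[OF n(2)] by auto
      moreover have "func (tup y) one X" using func_mem[OF u(1) z(4)] by simp
      ultimately show "\<exists>b y. func b one X \<and> (\<forall>i. i \<epsilon> one \<longrightarrow> (\<exists>k w. pr i k \<epsilon> tup h' \<and> pr c w \<epsilon> k \<and> pr i w \<epsilon> b)) \<and> pr b y \<epsilon> u \<and> pr c y \<epsilon> g"
        using z by (intro exI[of _ "tup y"] exI[of _ z]) auto
    qed
    then show "g \<epsilon> K"
      by (rule clone_composite[OF clone arity_one m(1) uK u(1) func_tup[OF \<open>h' \<epsilon> K\<close>], rotated])
        (use h'_func in auto)
  qed
qed

lemma precomplete_ideal_clone: "s \<epsilon> S \<Longrightarrow> precomplete X (ideal_clone s)"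
  unfolding precomplete_def using ideal_clone_proper clone_ideal_clone clone_above_ideal_clone by auto

text \<open>
The injection is \<open>s \<mapsto> ideal_clone s\<close>. It is separated from \<open>S \<times> P\<close> by a formula for its graph.
\<close>

lemma injection_exists: "\<exists>P F. (\<forall>K. K \<epsilon> P \<longleftrightarrow> precomplete X K) \<and> injection F S P"
proof -
  define P where "P = sep (pow (ops X)) (precomplete X)"
  have P: "K \<epsilon> P \<longleftrightarrow> precomplete X K" for K
    unfolding P_def mem_sep[OF definable_precomplete] using clone_iff by (auto simp: precomplete_def)
  have "\<exists>F. sub F (cart S P) \<and> (\<forall>s K. pr s K \<epsilon> F \<longleftrightarrow> s \<epsilon> S \<and> K \<epsilon> P \<and> (\<forall>f. f \<epsilon> K \<longleftrightarrow> operation X f \<and> preserves s f))"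
    by (rule sep_pairs) (intro definability)
  then obtain F where F: "sub F (cart S P)"
    "\<And>s K. pr s K \<epsilon> F \<longleftrightarrow> s \<epsilon> S \<and> K \<epsilon> P \<and> (\<forall>f. f \<epsilon> K \<longleftrightarrow> operation X f \<and> preserves s f)" by blast
  have F': "pr s K \<epsilon> F \<longleftrightarrow> s \<epsilon> S \<and> K = ideal_clone s" for s K
    unfolding F(2) P ext_iff[of K] mem_ideal_clone using precomplete_ideal_clone[of s] ext_iff[of K "ideal_clone s"] by auto
  have "func F S P" by (rule funcI[OF F(1)]) (unfold F', auto)
  then have "injection F S P" unfolding injection_def using ideal_clone_inject by (auto simp: F')
  then show ?thesis using P by blast
qed

end

context zf
begin

lemma sat_many: "satE e many_precomplete_clones"
  unfolding sat_many_precomplete_clones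
proof (intro allI impI)
  fix X assume "countably_infinite X"
  then obtain N where "bijection N om X" unfolding countably_infinite_def by auto
  then interpret countable_base E X N by unfold_locales
  from injection_exists show "\<exists>w t R S P F. omega w \<and> two t \<and> funspace w t R \<and> funspace R t S \<and>
      (\<forall>C. C \<epsilon> P \<longleftrightarrow> precomplete X C) \<and> injection F S P" by auto
qed

end

theorem theorem18: "ZF \<turnstile> many_precomplete_clones"
  by (rule ZF_derivable) (rule zf.sat_many)

end
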